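(* The contravariant functors $\mathcal{P}$ and $\mathrm{at}$ restrict to a dual adjunction, with units $\varepsilon$ and $\eta$, between the category $\mathbf{LCSob}$ of locally compact sober spaces and proper maps and the category $\mathbf{LCSobMT}$ of locally compact sober MT-algebras and proper MT-morphisms. Moreover, they restrict to a dual equivalence between $\mathbf{LCSob}$ and the full subcategory $\mathbf{LCSobSMT}$ of $\mathbf{LCSobMT}$ consisting of the spatial algebras.
   Context: An MT-algebra is a pair $M=(B,\square)$ where $B$ is a complete boolean algebra and $\square:B\to B$ satisfies $\square 1=1$, $\square(a\wedge b)=\square a\wedge\square b$, $\square a\le a$, $\square a\le\square\square a$. An MT-morphism $f:M\to N$ is a complete boolean homomorphism with $f(\square_M a)\le\square_N f(a)$ for all $a$. Put $\diamond a=\neg\square\neg a$. An element $a$ is open if $a=\square a$ and closed if $a=\diamond a$; $\mathrm{O}(M)$ and $\mathrm{C}(M)$ are the sets of open and closed elements. An element is saturated if it is a meet of open elements, and weakly locally closed if it is the meet of a saturated element and a closed element. $M$ is a $T_0$-algebra if every element is a join of weakly locally closed elements. $M$ is sober if it is a $T_0$-algebra and each join-irreducible (nonzero) element $p$ of $\mathrm{C}(M)$ is of the form $p=\diamond x$ for an atom $x$ of $M$. $M$ is spatial if $B$ is atomic. An element $a$ is compact if for each $S\subseteq\mathrm{O}(M)$ with $a\le\bigvee S$ there is a finite $T\subseteq S$ with $a\le\bigvee T$; $\mathrm{KS}(M)$ is the set of compact saturated elements. For $a,b\in M$ write $a\vartriangleleft b$ if there is a compact $k$ with $a\le k\le b$.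 $M$ is locally compact if $u=\bigvee\{v\in\mathrm{O}(M)\mid v\vartriangleleft u\}$ for all $u\in\mathrm{O}(M)$. An MT-morphism $f:M\to N$ between locally compact sober MT-algebras is proper if $a\in\mathrm{KS}(M)$ implies $f(a)\in\mathrm{KS}(N)$. A continuous map $f:X\to Y$ between locally compact sober spaces is proper if $f^{-1}(K)$ is compact for each compact saturated $K\subseteq Y$ (saturated = intersection of open sets). A space is locally compact if for each open $U$ and $x\in U$ there are an open $V$ and a compact $K$ with $x\in V\subseteq K\subseteq U$. Functors: $\mathcal{P}$ sends a space $X$ to $(\mathcal{P}(X),\mathrm{int})$ (the powerset with the interior operator) and a map $f$ to $f^{-1}$. $\mathrm{at}$ sends $M$ to its set of atoms $\mathrm{at}(M)$ with topology $\{\eta(a)\mid a\in\mathrm{O}(M)\}$, where $\eta(a)=\{x\in\mathrm{at}(M)\mid x\le a\}$, and an MT-morphism $f:M\to N$ to $\mathrm{at}(f):\mathrm{at}(N)\to\mathrm{at}(M)$, the restriction to atoms of the left adjoint $f^*(x)=\bigwedge\{a\in M\mid x\le f(a)\}$. The units are $\eta_M:M\to\mathcal{P}(\mathrm{at}(M))$ and $\varepsilon_X:X\to\mathrm{at}(\mathcal{P}(X))$, $\varepsilon_X(x)=\{x\}$. *)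

theory Defs
  imports "HOL-Analysis.Analysis" "HOL-Algebra.Complete_Lattice"
begin

section \<open>MT-algebras\<close>

record 'a mt_structure = "'a gorder" +
  mt_box :: "'a \<Rightarrow> 'a"

locale complete_boolean_lattice = complete_lattice +
  assumes meet_join_distrib:
    "\<lbrakk>x \<in> carrier L; y \<in> carrier L; z \<in> carrier L\<rbrakk>
      \<Longrightarrow> x \<sqinter> (y \<squnion> z) = (x \<sqinter> y) \<squnion> (x \<sqinter> z)"
    and complemented:
    "x \<in> carrier L \<Longrightarrow> \<exists>y\<in>carrier L. x \<sqinter> y = \<bottom> \<and> x \<squnion> y = \<top>"

locale mt_algebra = complete_boolean_lattice M
  for M :: "('a, 'm) mt_structure_scheme" (structure) +
  assumes box_closed: "a \<in> carrier M \<Longrightarrow> mt_box M a \<in> carrier M"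
    and box_top: "mt_box M \<top> = \<top>"
    and box_meet: "\<lbrakk>a \<in> carrier M; b \<in> carrier M\<rbrakk>
      \<Longrightarrow> mt_box M (a \<sqinter> b) = mt_box M a \<sqinter> mt_box M b"
    and box_le: "a \<in> carrier M \<Longrightarrow> mt_box M a \<sqsubseteq> a"
    and box_box: "a \<in> carrier M \<Longrightarrow> mt_box M a \<sqsubseteq> mt_box M (mt_box M a)"

definition mt_compl :: "('a, 'm) mt_structure_scheme \<Rightarrow> 'a \<Rightarrow> 'a" where
  "mt_compl M a =
    (THE b. b \<in> carrier M \<and> a \<sqinter>\<^bsub>M\<^esub> b = \<bottom>\<^bsub>M\<^esub> \<and> a \<squnion>\<^bsub>M\<^esub> b = \<top>\<^bsub>M\<^esub>)"

definition mt_diamond :: "('a, 'm) mt_structure_scheme \<Rightarrow> 'a \<Rightarrow> 'a" where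
  "mt_diamond M a = mt_compl M (mt_box M (mt_compl M a))"

definition mt_opens :: "('a, 'm) mt_structure_scheme \<Rightarrow> 'a set" where
  "mt_opens M = {a \<in> carrier M. a = mt_box M a}"

definition mt_closeds :: "('a, 'm) mt_structure_scheme \<Rightarrow> 'a set" where
  "mt_closeds M = {a \<in> carrier M. a = mt_diamond M a}"

definition mt_saturated :: "('a, 'm) mt_structure_scheme \<Rightarrow> 'a \<Rightarrow> bool" where
  "mt_saturated M a \<longleftrightarrow> (\<exists>S \<subseteq> mt_opens M. a = \<Sqinter>\<^bsub>M\<^esub> S)"

definition mt_weakly_locally_closed :: "('a, 'm) mt_structure_scheme \<Rightarrow> 'a \<Rightarrow> bool" where
  "mt_weakly_locally_closed M a \<longleftrightarrow>
    (\<exists>s c. mt_saturated M s \<and> c \<in> mt_closeds M \<and> a = s \<sqinter>\<^bsub>M\<^esub> c)"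

definition mt_T0 :: "('a, 'm) mt_structure_scheme \<Rightarrow> bool" where
  "mt_T0 M \<longleftrightarrow>
    (\<forall>a\<in>carrier M. \<exists>S \<subseteq> {w. mt_weakly_locally_closed M w}. a = \<Squnion>\<^bsub>M\<^esub> S)"

definition mt_atoms :: "('a, 'm) mt_structure_scheme \<Rightarrow> 'a set" where
  "mt_atoms M = {x \<in> carrier M. x \<noteq> \<bottom>\<^bsub>M\<^esub> \<and>
    (\<forall>y\<in>carrier M. y \<sqsubseteq>\<^bsub>M\<^esub> x \<longrightarrow> y = \<bottom>\<^bsub>M\<^esub> \<or> y = x)}"

definition mt_spatial :: "('a, 'm) mt_structure_scheme \<Rightarrow> bool" where
  "mt_spatial M \<longleftrightarrow>
    (\<forall>a\<in>carrier M. a \<noteq> \<bottom>\<^bsub>M\<^esub> \<longrightarrow> (\<exists>x\<in>mt_atoms M. x \<sqsubseteq>\<^bsub>M\<^esub> a))"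

definition mt_join_irreducible_closed :: "('a, 'm) mt_structure_scheme \<Rightarrow> 'a \<Rightarrow> bool" where
  "mt_join_irreducible_closed M p \<longleftrightarrow> p \<in> mt_closeds M \<and> p \<noteq> \<bottom>\<^bsub>M\<^esub> \<and>
    (\<forall>a\<in>mt_closeds M. \<forall>b\<in>mt_closeds M. p = a \<squnion>\<^bsub>M\<^esub> b \<longrightarrow> p = a \<or> p = b)"

definition mt_sober :: "('a, 'm) mt_structure_scheme \<Rightarrow> bool" where
  "mt_sober M \<longleftrightarrow> mt_T0 M \<and>
    (\<forall>p. mt_join_irreducible_closed M p \<longrightarrow> (\<exists>x\<in>mt_atoms M. p = mt_diamond M x))"

definition mt_compact :: "('a, 'm) mt_structure_scheme \<Rightarrow> 'a \<Rightarrow> bool" where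
  "mt_compact M a \<longleftrightarrow> a \<in> carrier M \<and>
    (\<forall>S \<subseteq> mt_opens M. a \<sqsubseteq>\<^bsub>M\<^esub> \<Squnion>\<^bsub>M\<^esub> S \<longrightarrow>
      (\<exists>T \<subseteq> S. finite T \<and> a \<sqsubseteq>\<^bsub>M\<^esub> \<Squnion>\<^bsub>M\<^esub> T))"

definition mt_KS :: "('a, 'm) mt_structure_scheme \<Rightarrow> 'a set" where
  "mt_KS M = {a. mt_compact M a \<and> mt_saturated M a}"

definition mt_below :: "('a, 'm) mt_structure_scheme \<Rightarrow> 'a \<Rightarrow> 'a \<Rightarrow> bool" where
  "mt_below M a b \<longleftrightarrow> (\<exists>k. mt_compact M k \<and> a \<sqsubseteq>\<^bsub>M\<^esub> k \<and> k \<sqsubseteq>\<^bsub>M\<^esub> b)"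

definition mt_locally_compact :: "('a, 'm) mt_structure_scheme \<Rightarrow> bool" where
  "mt_locally_compact M \<longleftrightarrow>
    (\<forall>u\<in>mt_opens M. u = \<Squnion>\<^bsub>M\<^esub> {v \<in> mt_opens M. mt_below M v u})"

text \<open>Morphisms are extensional functions, so that equality of morphisms is equality in HOL;
  composition is \<^term>\<open>compose (carrier M) g f\<close> and the identity is \<^term>\<open>\<lambda>a\<in>carrier M. a\<close>
  (with \<^const>\<open>topspace\<close> in place of \<^const>\<open>carrier\<close> for spaces).\<close>

definition mt_morphisms ::
  "('a, 'm) mt_structure_scheme \<Rightarrow> ('b, 'n) mt_structure_scheme \<Rightarrow> ('a \<Rightarrow> 'b) set" where
  "mt_morphisms M N = {f \<in> carrier M \<rightarrow>\<^sub>E carrier N.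
    (\<forall>S \<subseteq> carrier M. f (\<Squnion>\<^bsub>M\<^esub> S) = \<Squnion>\<^bsub>N\<^esub> (f ` S)) \<and>
    (\<forall>S \<subseteq> carrier M. f (\<Sqinter>\<^bsub>M\<^esub> S) = \<Sqinter>\<^bsub>N\<^esub> (f ` S)) \<and>
    (\<forall>a\<in>carrier M. f (mt_compl M a) = mt_compl N (f a)) \<and>
    (\<forall>a\<in>carrier M. f (mt_box M a) \<sqsubseteq>\<^bsub>N\<^esub> mt_box N (f a))}"


section \<open>Sober and locally compact spaces\<close>

definition irreducible_closedin :: "'a topology \<Rightarrow> 'a set \<Rightarrow> bool" where
  "irreducible_closedin X C \<longleftrightarrow> closedin X C \<and> C \<noteq> {} \<and>
    (\<forall>A B. closedin X A \<and> closedin X B \<and> C = A \<union> B \<longrightarrow> C = A \<or> C = B)"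

definition sober_space :: "'a topology \<Rightarrow> bool" where
  "sober_space X \<longleftrightarrow>
    (\<forall>C. irreducible_closedin X C \<longrightarrow> (\<exists>!x. x \<in> topspace X \<and> C = X closure_of {x}))"

text \<open>This is local compactness in the sense that every point has a base of compact
  neighbourhoods, as opposed to the weaker \<^const>\<open>locally_compact_space\<close>.\<close>

definition locally_compact_base :: "'a topology \<Rightarrow> bool" where
  "locally_compact_base X \<longleftrightarrow> neighbourhood_base_of (compactin X) X"

definition saturatedin :: "'a topology \<Rightarrow> 'a set \<Rightarrow> bool" where
  "saturatedin X K \<longleftrightarrow> (\<exists>\<U> \<subseteq> {U. openin X U}. K = topspace X \<inter> \<Inter>\<U>)"


section \<open>The categories\<close>

text \<open>The functors leave the type of the points (a space on \<open>'a\<close> is sent to an algebra on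
  \<open>'a set\<close>), so there is no single HOL type of objects closed under them. Objects are therefore
  indexed by arbitrary types and hom-sets relate objects over two possibly different types.\<close>

definition LCSob :: "'a topology set" where
  "LCSob = {X. sober_space X \<and> locally_compact_base X}"

text \<open>Properness here is not \<^const>\<open>proper_map\<close>: only preimages of compact saturated
  sets are required to be compact.\<close>

definition LCSob_hom :: "'a topology \<Rightarrow> 'b topology \<Rightarrow> ('a \<Rightarrow> 'b) set" where
  "LCSob_hom X Y = {f \<in> topspace X \<rightarrow>\<^sub>E topspace Y. continuous_map X Y f \<and>
    (\<forall>K. compactin Y K \<and> saturatedin Y K \<longrightarrow> compactin X {x \<in> topspace X. f x \<in> K})}"

definition LCSob_iso :: "'a topology \<Rightarrow> 'b topology \<Rightarrow> ('a \<Rightarrow> 'b) \<Rightarrow> bool" where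
  "LCSob_iso X Y f \<longleftrightarrow> f \<in> LCSob_hom X Y \<and>
    (\<exists>g\<in>LCSob_hom Y X. compose (topspace X) g f = (\<lambda>x\<in>topspace X. x) \<and>
      compose (topspace Y) f g = (\<lambda>y\<in>topspace Y. y))"

definition LCSobMT :: "'a mt_structure set" where
  "LCSobMT = {M. mt_algebra M \<and> mt_sober M \<and> mt_locally_compact M}"

definition LCSobMT_hom :: "'a mt_structure \<Rightarrow> 'b mt_structure \<Rightarrow> ('a \<Rightarrow> 'b) set" where
  "LCSobMT_hom M N = {f \<in> mt_morphisms M N. \<forall>a\<in>mt_KS M. f a \<in> mt_KS N}"

definition LCSobMT_iso :: "'a mt_structure \<Rightarrow> 'b mt_structure \<Rightarrow> ('a \<Rightarrow> 'b) \<Rightarrow> bool" where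
  "LCSobMT_iso M N f \<longleftrightarrow> f \<in> LCSobMT_hom M N \<and>
    (\<exists>g\<in>LCSobMT_hom N M. compose (carrier M) g f = (\<lambda>a\<in>carrier M. a) \<and>
      compose (carrier N) f g = (\<lambda>b\<in>carrier N. b))"

definition LCSobSMT :: "'a mt_structure set" where
  "LCSobSMT = {M \<in> LCSobMT. mt_spatial M}"


section \<open>The functors and the units\<close>

definition P_obj :: "'a topology \<Rightarrow> 'a set mt_structure" where
  "P_obj X = \<lparr>carrier = Pow (topspace X), eq = (=), le = (\<subseteq>), mt_box = (interior_of) X\<rparr>"

definition P_map :: "'a topology \<Rightarrow> 'b topology \<Rightarrow> ('a \<Rightarrow> 'b) \<Rightarrow> 'b set \<Rightarrow> 'a set" where
  "P_map X Y f = (\<lambda>A\<in>carrier (P_obj Y). {x \<in> topspace X. f x \<in> A})"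

definition eta :: "('a, 'm) mt_structure_scheme \<Rightarrow> 'a \<Rightarrow> 'a set" where
  "eta M = (\<lambda>a\<in>carrier M. {x \<in> mt_atoms M. x \<sqsubseteq>\<^bsub>M\<^esub> a})"

definition at_obj :: "('a, 'm) mt_structure_scheme \<Rightarrow> 'a topology" where
  "at_obj M = topology (\<lambda>U. \<exists>a\<in>mt_opens M. U = eta M a)"

definition at_map ::
  "('a, 'm) mt_structure_scheme \<Rightarrow> ('b, 'n) mt_structure_scheme \<Rightarrow> ('a \<Rightarrow> 'b) \<Rightarrow> 'b \<Rightarrow> 'a" where
  "at_map M N f = (\<lambda>x\<in>mt_atoms N. \<Sqinter>\<^bsub>M\<^esub> {a \<in> carrier M. x \<sqsubseteq>\<^bsub>N\<^esub> f a})"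

definition eps :: "'a topology \<Rightarrow> 'a \<Rightarrow> 'a set" where
  "eps X = (\<lambda>x\<in>topspace X. {x})"

text \<open>The sets \<^term>\<open>eta M a\<close> for open \<^term>\<open>a\<close> really form a topology, so that
  \<^const>\<open>at_obj\<close> is not a junk value of \<^const>\<open>topology\<close>.\<close>

lemma (in mt_algebra) atom_le_sup:
  assumes x: "x \<in> mt_atoms M" and S: "S \<subseteq> carrier M" and le: "x \<sqsubseteq> \<Squnion>S"
  shows "\<exists>s\<in>S. x \<sqsubseteq> s"
proof (rule ccontr)
  assume neg: "\<not> (\<exists>s\<in>S. x \<sqsubseteq> s)"
  have xc: "x \<in> carrier M" and x0: "x \<noteq> \<bottom>"
    and at: "\<And>y. \<lbrakk>y \<in> carrier M; y \<sqsubseteq> x\<rbrakk> \<Longrightarrow> y = \<bottom> \<or> y = x"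
    using x by (auto simp: mt_atoms_def)
  obtain c where c: "c \<in> carrier M" "x \<sqinter> c = \<bottom>" "x \<squnion> c = \<top>"
    using complemented[OF xc] by blast
  have "s \<sqsubseteq> c" if "s \<in> S" for s
  proof -
    have sc: "s \<in> carrier M" using that S by auto
    have "s \<sqinter> x = \<bottom>"
    proof -
      have "s \<sqinter> x \<noteq> x"
        using neg that sc xc meet_left by metis
      then show ?thesis using at[of "s \<sqinter> x"] sc xc meet_right by auto
    qed
    then have "s \<sqinter> (x \<squnion> c) = \<bottom> \<squnion> (s \<sqinter> c)"
      using meet_join_distrib[OF sc xc c(1)] by simp
    moreover have "s \<sqinter> (x \<squnion> c) = s"
    proof -
      have "s \<sqsubseteq> s \<sqinter> \<top>"
        using sc by (intro meet_le) auto
      then show ?thesis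
        using c(3) sc meet_left[of s "\<top>"] by (metis le_antisym meet_closed top_closed)
    qed
    moreover have "\<bottom> \<squnion> (s \<sqinter> c) \<sqsubseteq> c"
      using sc c(1) by (intro join_le) (auto intro: meet_right)
    ultimately show ?thesis by simp
  qed
  then have "\<Squnion>S \<sqsubseteq> c" using S c(1) by (intro sup_least) auto
  then have "x \<sqsubseteq> c" using le xc c(1) S le_trans[of x "\<Squnion>S" c] sup_closed by simp
  then have "x \<sqsubseteq> x \<sqinter> c" using xc c(1) by (intro meet_le) auto
  then show False using c(2) x0 xc by (metis bottom_closed bottom_lower le_antisym)
qed

lemma (in mt_algebra) istopology_at_obj:
  "istopology (\<lambda>U. \<exists>a\<in>mt_opens M. U = eta M a)"
  unfolding istopology_def
proof (intro conjI allI impI)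
  fix U V assume "\<exists>a\<in>mt_opens M. U = eta M a" "\<exists>a\<in>mt_opens M. V = eta M a"
  then obtain a b where ab: "a \<in> mt_opens M" "b \<in> mt_opens M" "U = eta M a" "V = eta M b"
    by blast
  then have c: "a \<in> carrier M" "b \<in> carrier M" by (auto simp: mt_opens_def)
  have "a \<sqinter> b \<in> mt_opens M" using ab c box_meet by (auto simp: mt_opens_def)
  moreover have "x \<sqsubseteq> a \<sqinter> b \<longleftrightarrow> x \<sqsubseteq> a \<and> x \<sqsubseteq> b" if "x \<in> carrier M" for x
    using that c meet_le meet_left meet_right le_trans by (meson meet_closed)
  then have "U \<inter> V = eta M (a \<sqinter> b)"
    using ab c by (auto simp: eta_def mt_atoms_def)
  ultimately show "\<exists>a\<in>mt_opens M. U \<inter> V = eta M a" by blast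
next
  fix K assume "\<forall>U\<in>K. \<exists>a\<in>mt_opens M. U = eta M a"
  then obtain g where g: "\<And>U. U \<in> K \<Longrightarrow> g U \<in> mt_opens M \<and> U = eta M (g U)" by metis
  define S where "S = g ` K"
  have S: "S \<subseteq> mt_opens M" and K: "K = eta M ` S" using g by (force simp: S_def)+
  have Sc: "S \<subseteq> carrier M" using S by (auto simp: mt_opens_def)
  then have supc: "\<Squnion>S \<in> carrier M" by (rule sup_closed)
  have "s \<sqsubseteq> mt_box M (\<Squnion>S)" if "s \<in> S" for s
  proof -
    have sc: "s \<in> carrier M" and sb: "mt_box M s = s" using that S by (auto simp: mt_opens_def)
    have "s \<sqsubseteq> \<Squnion>S" using Sc that by (rule sup_upper)
    then have "s \<sqinter> \<Squnion>S = s"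
      using sc supc by (meson le_antisym meet_closed meet_le meet_left le_refl)
    then have "s = s \<sqinter> mt_box M (\<Squnion>S)"
      using box_meet[OF sc supc] sb by simp
    then show ?thesis using meet_right[OF sc box_closed[OF supc]] by simp
  qed
  then have "\<Squnion>S \<sqsubseteq> mt_box M (\<Squnion>S)"
    using Sc supc box_closed by (intro sup_least) auto
  then have op: "\<Squnion>S \<in> mt_opens M"
    using box_le[OF supc] supc box_closed[OF supc] by (auto simp: mt_opens_def intro: le_antisym)
  have "eta M (\<Squnion>S) = \<Union>K"
  proof
    show "eta M (\<Squnion>S) \<subseteq> \<Union>K"
    proof
      fix x assume "x \<in> eta M (\<Squnion>S)"
      then have "x \<in> mt_atoms M" "x \<sqsubseteq> \<Squnion>S" using supc by (auto simp: eta_def)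
      moreover from this obtain s where "s \<in> S" "x \<sqsubseteq> s" using atom_le_sup Sc by blast
      ultimately show "x \<in> \<Union>K" using K Sc by (auto simp: eta_def)
    qed
    have "x \<sqsubseteq> \<Squnion>S" if "x \<in> carrier M" "s \<in> S" "x \<sqsubseteq> s" for x s
      using that Sc supc sup_upper[OF Sc that(2)] le_trans[of x s "\<Squnion>S"] by auto
    then have "eta M s \<subseteq> eta M (\<Squnion>S)" if "s \<in> S" for s
      using that Sc supc by (auto simp: eta_def mt_atoms_def subset_iff)
    then show "\<Union>K \<subseteq> eta M (\<Squnion>S)"
      unfolding K by blast
  qed
  then show "\<exists>a\<in>mt_opens M. \<Union>K = eta M a" using op by metis
qed

lemma (in mt_algebra) openin_at_obj:
  "openin (at_obj M) U \<longleftrightarrow> (\<exists>a\<in>mt_opens M. U = eta M a)"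
  by (simp add: at_obj_def topology_inverse'[OF istopology_at_obj])

lemma mt_algebra_P_obj: "mt_algebra (P_obj X)"
proof -
  let ?P = "P_obj X"
  interpret partial_order ?P
    by unfold_locales (auto simp: P_obj_def)
  have car: "carrier ?P = Pow (topspace X)" and le: "le ?P = (\<subseteq>)" by (auto simp: P_obj_def)
  have lub: "least ?P (\<Union>A) (Upper ?P A)" if A: "A \<subseteq> carrier ?P" for A
    unfolding least_def Upper_def car le using A[unfolded car] by blast
  have glb: "greatest ?P (topspace X \<inter> \<Inter>A) (Lower ?P A)" if A: "A \<subseteq> carrier ?P" for A
    unfolding greatest_def Lower_def car le using A[unfolded car] by blast
  interpret complete_lattice ?P
    by unfold_locales (use lub glb in blast)+
  have join: "a \<squnion>\<^bsub>?P\<^esub> b = a \<union> b" if "a \<in> carrier ?P" "b \<in> carrier ?P" for a b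
  proof -
    have "least ?P (a \<union> b) (Upper ?P {a, b})" using lub[of "{a, b}"] that by simp
    then show ?thesis unfolding join_def sup_def
      by (metis (no_types, lifting) someI least_unique)
  qed
  have meet: "a \<sqinter>\<^bsub>?P\<^esub> b = a \<inter> b" if "a \<in> carrier ?P" "b \<in> carrier ?P" for a b
  proof -
    have "topspace X \<inter> \<Inter>{a, b} = a \<inter> b" using that car by auto
    then have "greatest ?P (a \<inter> b) (Lower ?P {a, b})" using glb[of "{a, b}"] that by simp
    then show ?thesis unfolding meet_def inf_def
      by (metis (no_types, lifting) someI greatest_unique)
  qed
  have top: "\<top>\<^bsub>?P\<^esub> = topspace X"
    using top_closed top_higher[of "topspace X"] unfolding car le by auto
  have bot: "\<bottom>\<^bsub>?P\<^esub> = {}"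
    using bottom_closed bottom_lower[of "{}"] unfolding car le by auto
  have box: "mt_box ?P = (interior_of) X" by (simp add: P_obj_def)
  have int: "X interior_of a \<in> carrier ?P" for a
    by (simp add: car interior_of_subset_topspace)
  show ?thesis
  proof unfold_locales
    fix x assume x: "x \<in> carrier ?P"
    have "topspace X - x \<in> carrier ?P" by (simp add: car)
    moreover have "x \<inter> (topspace X - x) = {}" "x \<union> (topspace X - x) = topspace X"
      using x car by auto
    ultimately show "\<exists>y\<in>carrier ?P. x \<sqinter>\<^bsub>?P\<^esub> y = \<bottom>\<^bsub>?P\<^esub> \<and> x \<squnion>\<^bsub>?P\<^esub> y = \<top>\<^bsub>?P\<^esub>"
      using x by (metis bot join meet top)
  next
    fix x y z assume "x \<in> carrier ?P" "y \<in> carrier ?P" "z \<in> carrier ?P"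
    moreover from this have "x \<inter> y \<in> carrier ?P" "x \<inter> z \<in> carrier ?P" "y \<union> z \<in> carrier ?P"
      using car by auto
    ultimately show "x \<sqinter>\<^bsub>?P\<^esub> (y \<squnion>\<^bsub>?P\<^esub> z) = x \<sqinter>\<^bsub>?P\<^esub> y \<squnion>\<^bsub>?P\<^esub> x \<sqinter>\<^bsub>?P\<^esub> z"
      by (simp add: join meet Int_Un_distrib)
  qed (simp_all add: box int meet top le interior_of_subset interior_of_Int)
qed

end

theory Submission
  imports Defs
begin

text \<open>The only step that is not routine is that \<open>\<eta>\<close> preserves compact saturated elements even when \<open>M\<close> is
  not spatial. If \<open>k\<close> is compact saturated and \<open>w\<close> is an open element with \<open>\<not> k \<le> w\<close>, then by
  compactness of \<open>k\<close> there is a maximal open \<open>p \<ge> w\<close> with \<open>\<not> k \<le> p\<close>. Such a \<open>p\<close> is prime, so by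
  sobriety its complement is \<open>\<diamond>x\<close> for an atom \<open>x\<close>; this \<open>x\<close> lies below every open above \<open>k\<close>,
  hence below \<open>k\<close>, but not below \<open>w\<close>. So \<open>k \<le> w\<close> iff \<open>\<eta>(k) \<subseteq> \<eta>(w)\<close>, and \<open>\<eta>\<close> maps the compact saturated
  elements of \<open>M\<close> onto the compact saturated sets of \<open>at(M)\<close>. Local compactness of \<open>at(M)\<close> and properness
  of \<open>at(f)\<close> follow.\<close>

section \<open>Order, complements and atoms\<close>

text \<open>A nonzero element of \<open>M\<close> may have no atom below it, so without spatiality
  \<open>eta M\<close> is not injective and an inclusion of sets of atoms says nothing about the
  order of \<open>M\<close> in general. The comparison of a compact saturated element with an open
  one is the exception, and it suffices because compactness speaks only of inequalities
  \<open>k \<sqsubseteq> \<Squnion>S\<close> with an open right-hand side: a cover can be lifted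
  from atoms to \<open>M\<close>, thinned out there and pushed down again. The element
  \<open>p\<close> is prime because any open element not below it, joined with \<open>p\<close>,
  lies above \<open>k\<close> by maximality; for two such elements \<open>a\<close> and
  \<open>b\<close>, distributivity puts \<open>k\<close> below
  \<open>p \<squnion> (a \<sqinter> b)\<close>, which rules out
  \<open>a \<sqinter> b \<sqsubseteq> p\<close>. Properness of \<open>at_map M N f\<close> follows
  because its preimage of \<open>eta M k\<close> is \<open>eta N (f k)\<close>, where
  \<open>f k\<close> is again compact saturated. For local compactness, the element interpolated
  between two opens is merely compact; it is replaced by the meet of all opens above it, which has
  the same opens above it. Sobriety of an algebra yields only the existence of an atom with a given
  closure; its uniqueness, which sobriety of a space includes, comes from the \<open>T0\<close>
  condition.\<close>

context mt_algebra
begin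

lemma meet_commute: "a \<sqinter> b = b \<sqinter> a"
  by (simp add: meet_def insert_commute)

lemma le_meet_iff:
  assumes "a \<in> carrier M" "b \<in> carrier M" "c \<in> carrier M"
  shows "a \<sqsubseteq> b \<sqinter> c \<longleftrightarrow> a \<sqsubseteq> b \<and> a \<sqsubseteq> c"
  using assms by (meson le_trans meet_closed meet_le meet_left meet_right)

lemma join_le_iff:
  assumes "a \<in> carrier M" "b \<in> carrier M" "c \<in> carrier M"
  shows "a \<squnion> b \<sqsubseteq> c \<longleftrightarrow> a \<sqsubseteq> c \<and> b \<sqsubseteq> c"
  using assms by (meson le_trans join_closed join_le join_left join_right)

lemma sup_le_iff:
  assumes "S \<subseteq> carrier M" "c \<in> carrier M"
  shows "\<Squnion>S \<sqsubseteq> c \<longleftrightarrow> (\<forall>s\<in>S. s \<sqsubseteq> c)"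
  using assms by (meson le_trans subsetD sup_closed sup_least sup_upper)

lemma le_inf_iff:
  assumes "S \<subseteq> carrier M" "c \<in> carrier M"
  shows "c \<sqsubseteq> \<Sqinter>S \<longleftrightarrow> (\<forall>s\<in>S. c \<sqsubseteq> s)"
  using assms by (meson le_trans subsetD inf_closed inf_greatest inf_lower)

lemma le_bot_iff: "a \<in> carrier M \<Longrightarrow> a \<sqsubseteq> \<bottom> \<longleftrightarrow> a = \<bottom>"
  using bottom_lower bottom_closed le_antisym le_refl by blast

lemma meet_absorb: "\<lbrakk>a \<in> carrier M; b \<in> carrier M; a \<sqsubseteq> b\<rbrakk> \<Longrightarrow> a \<sqinter> b = a"
  by (meson le_antisym le_refl meet_closed meet_le meet_left)

text \<open>Distributing \<open>b\<close> over \<open>a \<squnion> c\<close> kills the part inside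
  \<open>a\<close>. Applied in both directions to two complements of the same element, this is their
  uniqueness, and so the \<open>THE\<close> in \<open>mt_compl\<close> is well defined.\<close>

lemma disjoint_le_codisjoint:
  assumes "a \<in> carrier M" "b \<in> carrier M" "c \<in> carrier M"
    and "a \<sqinter> b = \<bottom>" "a \<squnion> c = \<top>"
  shows "b \<sqsubseteq> c"
proof -
  have "b = b \<sqinter> (a \<squnion> c)"
    using assms(2,5) top_higher meet_absorb[of b \<top>] by simp
  also have "\<dots> = (b \<sqinter> a) \<squnion> (b \<sqinter> c)"
    using assms(1-3) by (simp add: meet_join_distrib)
  also have "\<dots> = \<bottom> \<squnion> (b \<sqinter> c)"
    using assms(4) meet_commute by metis
  also have "\<dots> \<sqsubseteq> c"
    using assms by (intro join_le) (auto intro: meet_right bottom_lower)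
  finally show ?thesis .
qed

lemma compl_props:
  assumes "a \<in> carrier M"
  shows "mt_compl M a \<in> carrier M \<and> a \<sqinter> mt_compl M a = \<bottom> \<and> a \<squnion> mt_compl M a = \<top>"
  unfolding mt_compl_def
proof (rule theI')
  obtain b where b: "b \<in> carrier M" "a \<sqinter> b = \<bottom>" "a \<squnion> b = \<top>"
    using complemented[OF assms] by blast
  show "\<exists>!b. b \<in> carrier M \<and> a \<sqinter> b = \<bottom> \<and> a \<squnion> b = \<top>"
    using b disjoint_le_codisjoint assms le_antisym by blast
qed

lemmas compl_closed [simp] = compl_props[THEN conjunct1]
  and meet_compl = compl_props[THEN conjunct2, THEN conjunct1]
  and join_compl = compl_props[THEN conjunct2, THEN conjunct2]

lemma le_compl_iff:
  assumes "a \<in> carrier M" "b \<in> carrier M"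
  shows "b \<sqsubseteq> mt_compl M a \<longleftrightarrow> a \<sqinter> b = \<bottom>"
proof
  assume "a \<sqinter> b = \<bottom>"
  then show "b \<sqsubseteq> mt_compl M a"
    using disjoint_le_codisjoint[of a b "mt_compl M a"] assms join_compl by simp
next
  assume "b \<sqsubseteq> mt_compl M a"
  then have "a \<sqinter> b \<sqsubseteq> mt_compl M a"
    using assms le_trans[OF meet_right[of a b]] by simp
  then have "a \<sqinter> b \<sqsubseteq> a \<sqinter> mt_compl M a"
    using assms by (simp add: le_meet_iff meet_left)
  then show "a \<sqinter> b = \<bottom>"
    using assms by (simp add: meet_compl le_bot_iff)
qed

lemma compl_eqI:
  assumes "a \<in> carrier M" "b \<in> carrier M" "a \<sqinter> b = \<bottom>" "a \<squnion> b = \<top>"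
  shows "mt_compl M a = b"
proof (rule le_antisym)
  show "mt_compl M a \<sqsubseteq> b" using assms meet_compl by (intro disjoint_le_codisjoint[of a]) auto
  show "b \<sqsubseteq> mt_compl M a" using assms by (simp add: le_compl_iff)
qed (use assms in auto)

lemma compl_compl [simp]: "a \<in> carrier M \<Longrightarrow> mt_compl M (mt_compl M a) = a"
  by (intro compl_eqI) (auto simp: meet_commute[of _ a] join_comm[of M _ a] meet_compl join_compl)

lemma compl_le_compl_iff:
  assumes "a \<in> carrier M" "b \<in> carrier M"
  shows "mt_compl M a \<sqsubseteq> mt_compl M b \<longleftrightarrow> b \<sqsubseteq> a"
proof -
  have "mt_compl M a \<sqsubseteq> mt_compl M b \<longleftrightarrow> mt_compl M a \<sqinter> b = \<bottom>"
    using assms by (simp add: le_compl_iff meet_commute)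
  also have "\<dots> \<longleftrightarrow> b \<sqsubseteq> a"
    using assms le_compl_iff[of "mt_compl M a" b] by simp
  finally show ?thesis .
qed

lemma compl_inj: "\<lbrakk>mt_compl M a = mt_compl M b; a \<in> carrier M; b \<in> carrier M\<rbrakk> \<Longrightarrow> a = b"
  by (metis compl_compl)

lemma compl_top: "mt_compl M \<top> = \<bottom>"
  using le_bot_iff meet_absorb[of "mt_compl M \<top>" \<top>] meet_compl[of \<top>] top_higher meet_commute
  by (metis compl_closed top_closed)

lemma atom_carrier: "x \<in> mt_atoms M \<Longrightarrow> x \<in> carrier M"
  by (simp add: mt_atoms_def)

lemma atom_not_le_bot: "x \<in> mt_atoms M \<Longrightarrow> \<not> x \<sqsubseteq> \<bottom>"
  by (simp add: mt_atoms_def le_bot_iff)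

text \<open>The meet of \<open>a\<close> with an atom is either the atom or bottom, so every element
  is decided at an atom. This is why \<open>eta M\<close> commutes with complements.\<close>

lemma atom_le_compl_iff:
  assumes "x \<in> mt_atoms M" "a \<in> carrier M"
  shows "x \<sqsubseteq> mt_compl M a \<longleftrightarrow> \<not> x \<sqsubseteq> a"
proof -
  have x: "x \<in> carrier M" "x \<noteq> \<bottom>"
    and at: "\<And>y. \<lbrakk>y \<in> carrier M; y \<sqsubseteq> x\<rbrakk> \<Longrightarrow> y = \<bottom> \<or> y = x"
    using assms by (auto simp: mt_atoms_def)
  have "a \<sqinter> x = \<bottom> \<or> a \<sqinter> x = x" using at x assms meet_right by simp
  moreover have "a \<sqinter> x = x \<longleftrightarrow> x \<sqsubseteq> a"
    using x assms meet_absorb[of x a] meet_left[of a x] by (auto simp: meet_commute[of a])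
  ultimately show ?thesis using le_compl_iff[OF assms(2) x(1)] x(2) by auto
qed

lemma atom_le_sup_iff:
  assumes "x \<in> mt_atoms M" "S \<subseteq> carrier M"
  shows "x \<sqsubseteq> \<Squnion>S \<longleftrightarrow> (\<exists>s\<in>S. x \<sqsubseteq> s)"
  using assms atom_le_sup by (meson atom_carrier le_trans subsetD sup_closed sup_upper)

lemma atom_le_atom_iff:
  assumes "x \<in> mt_atoms M" "y \<in> mt_atoms M"
  shows "x \<sqsubseteq> y \<longleftrightarrow> x = y"
  using assms by (auto simp: mt_atoms_def)

section \<open>Open, closed and saturated elements\<close>

lemma open_carrier: "u \<in> mt_opens M \<Longrightarrow> u \<in> carrier M"
  and opens_carrier: "mt_opens M \<subseteq> carrier M"
  by (auto simp: mt_opens_def)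

lemma box_mono:
  assumes "a \<in> carrier M" "b \<in> carrier M" "a \<sqsubseteq> b"
  shows "mt_box M a \<sqsubseteq> mt_box M b"
  using box_meet[of a b] assms meet_absorb[of a b] box_closed meet_right by metis

lemma box_open: "a \<in> carrier M \<Longrightarrow> mt_box M a \<in> mt_opens M"
  by (auto simp: mt_opens_def box_closed intro!: le_antisym box_box box_le)

lemma openI: "\<lbrakk>a \<in> carrier M; a \<sqsubseteq> mt_box M a\<rbrakk> \<Longrightarrow> a \<in> mt_opens M"
  by (auto simp: mt_opens_def box_closed intro!: le_antisym box_le)

lemma open_le_box_iff:
  assumes "u \<in> mt_opens M" "a \<in> carrier M"
  shows "u \<sqsubseteq> mt_box M a \<longleftrightarrow> u \<sqsubseteq> a"
  using assms box_mono[of u a] box_le[of a] box_closed le_trans[of u "mt_box M a" a]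
  by (auto simp: mt_opens_def)

lemma open_top: "\<top> \<in> mt_opens M"
  by (simp add: mt_opens_def box_top)

lemma open_sup:
  assumes "S \<subseteq> mt_opens M"
  shows "\<Squnion>S \<in> mt_opens M"
proof (rule openI)
  have S: "S \<subseteq> carrier M" using assms opens_carrier by blast
  then show "\<Squnion>S \<in> carrier M" by simp
  then show "\<Squnion>S \<sqsubseteq> mt_box M (\<Squnion>S)"
    using S assms sup_upper[OF S]
    by (subst sup_le_iff) (auto simp: box_closed open_le_box_iff subset_iff)
qed

lemma diamond_carrier: "a \<in> carrier M \<Longrightarrow> mt_diamond M a \<in> carrier M"
  by (simp add: mt_diamond_def box_closed)

text \<open>Complementation is an involution, so the fixpoint equation of the diamond at
  \<open>c\<close> is that of the box at \<open>mt_compl M c\<close>.\<close>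

lemma closed_iff: "c \<in> mt_closeds M \<longleftrightarrow> c \<in> carrier M \<and> mt_compl M c \<in> mt_opens M"
proof (cases "c \<in> carrier M")
  case True
  then have "c = mt_diamond M c \<longleftrightarrow> mt_compl M c = mt_box M (mt_compl M c)"
    unfolding mt_diamond_def using box_closed compl_closed by (metis compl_compl)
  then show ?thesis using True by (simp add: mt_closeds_def mt_opens_def)
qed (simp add: mt_closeds_def)

lemma closed_carrier: "c \<in> mt_closeds M \<Longrightarrow> c \<in> carrier M"
  by (simp add: mt_closeds_def)

lemma compl_open_closed: "u \<in> mt_opens M \<Longrightarrow> mt_compl M u \<in> mt_closeds M"
  by (simp add: closed_iff open_carrier)

lemma diamond_closed: "a \<in> carrier M \<Longrightarrow> mt_diamond M a \<in> mt_closeds M"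
  by (simp add: mt_diamond_def compl_open_closed box_open)

lemma le_diamond: "a \<in> carrier M \<Longrightarrow> a \<sqsubseteq> mt_diamond M a"
  using compl_le_compl_iff[of "mt_compl M a" "mt_box M (mt_compl M a)"]
  by (simp add: mt_diamond_def box_le box_closed)

text \<open>The dual of \<open>open_le_box_iff\<close> under complements:
  \<open>mt_diamond M a\<close> is the least closed element above \<open>a\<close>.\<close>

lemma diamond_le_iff:
  assumes "a \<in> carrier M" "c \<in> mt_closeds M"
  shows "mt_diamond M a \<sqsubseteq> c \<longleftrightarrow> a \<sqsubseteq> c"
proof -
  have c: "c \<in> carrier M" "mt_compl M c \<in> mt_opens M" using assms closed_iff by auto
  have "mt_diamond M a \<sqsubseteq> c \<longleftrightarrow> mt_compl M c \<sqsubseteq> mt_box M (mt_compl M a)"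
    using c assms compl_le_compl_iff[of "mt_box M (mt_compl M a)" "mt_compl M c"]
    by (simp add: mt_diamond_def box_closed)
  also have "\<dots> \<longleftrightarrow> mt_compl M c \<sqsubseteq> mt_compl M a"
    using c assms by (intro open_le_box_iff) auto
  also have "\<dots> \<longleftrightarrow> a \<sqsubseteq> c" using c assms by (simp add: compl_le_compl_iff)
  finally show ?thesis .
qed

lemma saturated_carrier: "mt_saturated M s \<Longrightarrow> s \<in> carrier M"
  unfolding mt_saturated_def using opens_carrier by (metis inf_closed order_trans)

text \<open>If some family of opens has meet \<open>s\<close>, then so does the family of all opens
  above \<open>s\<close>. The right-hand side is the universal property of that canonical meet,
  which frees later arguments from choosing a family.\<close>

lemma saturated_iff:
  "mt_saturated M s \<longleftrightarrow> s \<in> carrier M \<and>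
    (\<forall>b\<in>carrier M. (\<forall>u\<in>mt_opens M. s \<sqsubseteq> u \<longrightarrow> b \<sqsubseteq> u) \<longrightarrow> b \<sqsubseteq> s)"
proof
  assume s: "mt_saturated M s"
  then obtain S where S: "S \<subseteq> mt_opens M" "s = \<Sqinter>S" by (auto simp: mt_saturated_def)
  then have "S \<subseteq> carrier M" using opens_carrier by blast
  then show "s \<in> carrier M \<and>
    (\<forall>b\<in>carrier M. (\<forall>u\<in>mt_opens M. s \<sqsubseteq> u \<longrightarrow> b \<sqsubseteq> u) \<longrightarrow> b \<sqsubseteq> s)"
    using S inf_lower by (auto simp: le_inf_iff subset_iff)
next
  assume s: "s \<in> carrier M \<and>
    (\<forall>b\<in>carrier M. (\<forall>u\<in>mt_opens M. s \<sqsubseteq> u \<longrightarrow> b \<sqsubseteq> u) \<longrightarrow> b \<sqsubseteq> s)"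
  let ?S = "{u \<in> mt_opens M. s \<sqsubseteq> u}"
  have S: "?S \<subseteq> carrier M" using opens_carrier by blast
  have "s = \<Sqinter>?S"
  proof (rule le_antisym)
    show "s \<sqsubseteq> \<Sqinter>?S" using conjunct1[OF s] by (simp add: le_inf_iff[OF S])
    have "\<forall>u\<in>mt_opens M. s \<sqsubseteq> u \<longrightarrow> \<Sqinter>?S \<sqsubseteq> u" using inf_lower[OF S] by simp
    then show "\<Sqinter>?S \<sqsubseteq> s" by (rule mp[OF bspec[OF conjunct2[OF s] inf_closed[OF S]]])
    show "s \<in> carrier M" by (rule conjunct1[OF s])
    show "\<Sqinter>?S \<in> carrier M" by (rule inf_closed[OF S])
  qed
  moreover have "?S \<subseteq> mt_opens M" by blast
  ultimately show "mt_saturated M s"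
    unfolding mt_saturated_def by (intro exI[of _ ?S] conjI)
qed

lemma saturated_leI:
  assumes "mt_saturated M s" "b \<in> carrier M"
    and "\<And>u. \<lbrakk>u \<in> mt_opens M; s \<sqsubseteq> u\<rbrakk> \<Longrightarrow> b \<sqsubseteq> u"
  shows "b \<sqsubseteq> s"
  using assms saturated_iff by simp

lemma saturated_inf:
  assumes "A \<subseteq> mt_opens M"
  shows "mt_saturated M (\<Sqinter>A)"
  using assms unfolding mt_saturated_def by blast

lemma compact_carrier: "mt_compact M k \<Longrightarrow> k \<in> carrier M"
  by (simp add: mt_compact_def)

section \<open>The map \<open>eta\<close> and the topology on the atoms\<close>

lemma eta_eq: "a \<in> carrier M \<Longrightarrow> eta M a = {x \<in> mt_atoms M. x \<sqsubseteq> a}"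
  by (simp add: eta_def)

lemma eta_subset_atoms: "a \<in> carrier M \<Longrightarrow> eta M a \<subseteq> mt_atoms M"
  by (auto simp: eta_eq)

lemma eta_mono: "\<lbrakk>a \<in> carrier M; b \<in> carrier M; a \<sqsubseteq> b\<rbrakk> \<Longrightarrow> eta M a \<subseteq> eta M b"
  by (auto simp: eta_eq intro: le_trans atom_carrier)

lemma eta_top: "eta M \<top> = mt_atoms M"
  by (auto simp: eta_eq top_higher atom_carrier)

lemma eta_sup: "S \<subseteq> carrier M \<Longrightarrow> eta M (\<Squnion>S) = \<Union>(eta M ` S)"
  by (auto simp: eta_eq atom_le_sup_iff subset_iff)

text \<open>The factor \<open>mt_atoms M\<close> gives the right value for the empty family, whose
  meet is the top element.\<close>

lemma eta_inf: "S \<subseteq> carrier M \<Longrightarrow> eta M (\<Sqinter>S) = mt_atoms M \<inter> \<Inter>(eta M ` S)"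
  by (auto simp: eta_eq le_inf_iff subset_iff atom_carrier)

lemma eta_join:
  assumes "a \<in> carrier M" "b \<in> carrier M"
  shows "eta M (a \<squnion> b) = eta M a \<union> eta M b"
  unfolding join_def using eta_sup[of "{a, b}"] assms by simp

lemma eta_compl: "a \<in> carrier M \<Longrightarrow> eta M (mt_compl M a) = mt_atoms M - eta M a"
  by (auto simp: eta_eq atom_le_compl_iff)

lemma eta_atom: "x \<in> mt_atoms M \<Longrightarrow> eta M x = {x}"
  by (auto simp: eta_eq atom_carrier atom_le_atom_iff)

lemma topspace_at_obj: "topspace (at_obj M) = mt_atoms M"
proof (rule subset_antisym)
  show "topspace (at_obj M) \<subseteq> mt_atoms M"
    using openin_topspace[of "at_obj M"] eta_subset_atoms open_carrier
    unfolding openin_at_obj by blast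
  show "mt_atoms M \<subseteq> topspace (at_obj M)"
    using eta_top open_top openin_at_obj openin_subset by metis
qed

lemma closedin_at_obj: "closedin (at_obj M) C \<longleftrightarrow> (\<exists>c\<in>mt_closeds M. C = eta M c)"
proof
  assume "closedin (at_obj M) C"
  then have C: "C \<subseteq> mt_atoms M" "openin (at_obj M) (mt_atoms M - C)"
    by (auto simp: closedin_def topspace_at_obj)
  then obtain u where u: "u \<in> mt_opens M" "mt_atoms M - C = eta M u"
    by (auto simp: openin_at_obj)
  then have "C = eta M (mt_compl M u)" using C by (auto simp: eta_compl open_carrier)
  then show "\<exists>c\<in>mt_closeds M. C = eta M c" using u compl_open_closed by blast
next
  assume "\<exists>c\<in>mt_closeds M. C = eta M c"
  then obtain c where c: "c \<in> mt_closeds M" "C = eta M c" by blast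
  then have "mt_atoms M - C = eta M (mt_compl M c)" "mt_compl M c \<in> mt_opens M"
    by (auto simp: eta_compl closed_iff)
  then show "closedin (at_obj M) C"
    unfolding closedin_def topspace_at_obj openin_at_obj
    using c closed_carrier eta_subset_atoms by blast
qed

text \<open>A closed set \<open>eta M c\<close> contains \<open>A\<close> iff
  \<open>\<Squnion>A \<sqsubseteq> c\<close>, and the least closed \<open>c\<close> with this
  property is the diamond of the join.\<close>

lemma closure_of_at_obj:
  assumes "A \<subseteq> mt_atoms M"
  shows "at_obj M closure_of A = eta M (mt_diamond M (\<Squnion>A))"
proof (rule closure_of_unique)
  have A: "A \<subseteq> carrier M" using assms atom_carrier by blast
  then have d: "mt_diamond M (\<Squnion>A) \<in> mt_closeds M" by (simp add: diamond_closed)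
  then show "closedin (at_obj M) (eta M (mt_diamond M (\<Squnion>A)))"
    unfolding closedin_at_obj by blast
  have *: "A \<subseteq> eta M c \<longleftrightarrow> \<Squnion>A \<sqsubseteq> c" if "c \<in> carrier M" for c
    using that assms A by (auto simp: sup_le_iff eta_eq)
  show "A \<subseteq> eta M (mt_diamond M (\<Squnion>A))"
    using * d le_diamond A by (simp add: closed_carrier)
  show "eta M (mt_diamond M (\<Squnion>A)) \<subseteq> T" if T: "A \<subseteq> T" "closedin (at_obj M) T" for T
  proof -
    obtain c where c: "c \<in> mt_closeds M" "T = eta M c" using T(2) by (auto simp: closedin_at_obj)
    then have "\<Squnion>A \<sqsubseteq> c" using * T closed_carrier by blast
    then have "mt_diamond M (\<Squnion>A) \<sqsubseteq> c" using c A by (simp add: diamond_le_iff)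
    then show ?thesis using c d by (simp add: closed_carrier eta_mono)
  qed
qed

text \<open>Writing \<open>x\<close> as a join of weakly locally closed elements, join-primeness of
  the atom shows that \<open>x\<close> is itself one of them, say \<open>s \<sqinter> c\<close>.
  Opens control both factors: \<open>c\<close> through its complement, \<open>s\<close> because it
  is saturated. So \<open>y\<close> lies below both and hence below \<open>x\<close>.\<close>

lemma T0_atom_eqI:
  assumes T0: "mt_T0 M" and x: "x \<in> mt_atoms M" and y: "y \<in> mt_atoms M"
    and eq: "\<And>u. u \<in> mt_opens M \<Longrightarrow> x \<sqsubseteq> u \<longleftrightarrow> y \<sqsubseteq> u"
  shows "x = y"
proof -
  note xc = atom_carrier[OF x] and yc = atom_carrier[OF y]
  have wc: "w \<in> carrier M" if "mt_weakly_locally_closed M w" for w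
    using that unfolding mt_weakly_locally_closed_def
    by (auto simp: saturated_carrier closed_carrier)
  obtain S where S: "S \<subseteq> {w. mt_weakly_locally_closed M w}" "x = \<Squnion>S"
    using T0 xc unfolding mt_T0_def by blast
  have Sc: "S \<subseteq> carrier M" using S wc by blast
  then obtain w where w: "w \<in> S" "x \<sqsubseteq> w" using atom_le_sup[OF x] S xc le_refl by metis
  then have "w = x" using S Sc sup_upper xc by (meson le_antisym subsetD)
  then obtain s c where sc: "mt_saturated M s" "c \<in> mt_closeds M" "x = s \<sqinter> c"
    using w S by (auto simp: mt_weakly_locally_closed_def)
  have s: "s \<in> carrier M" and c: "c \<in> carrier M" and co: "mt_compl M c \<in> mt_opens M"
    using sc saturated_carrier closed_iff by auto
  have "x \<sqsubseteq> s" "x \<sqsubseteq> c" using sc s c meet_left meet_right by auto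
  then have "y \<sqsubseteq> c" using eq[OF co] x y c by (simp add: atom_le_compl_iff)
  moreover have "y \<sqsubseteq> s"
    using sc(1) \<open>x \<sqsubseteq> s\<close> s xc yc eq open_carrier unfolding saturated_iff by (meson le_trans)
  ultimately have "y \<sqsubseteq> x" using sc s c yc by (simp add: le_meet_iff)
  then show ?thesis using x y atom_le_atom_iff by simp
qed

text \<open>A finite subfamily of a nonempty chain has an upper bound inside the chain. It follows
  that the opens not above a compact \<open>k\<close> are closed under joins of nonempty chains, as
  Zorn's lemma will require.\<close>

lemma compact_chain_sup:
  assumes k: "mt_compact M k" and C: "C \<subseteq> mt_opens M" "C \<noteq> {}"
    and chain: "\<And>u v. \<lbrakk>u \<in> C; v \<in> C\<rbrakk> \<Longrightarrow> u \<sqsubseteq> v \<or> v \<sqsubseteq> u" and le: "k \<sqsubseteq> \<Squnion>C"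
  shows "\<exists>u\<in>C. k \<sqsubseteq> u"
proof -
  have Cc: "C \<subseteq> carrier M" using C opens_carrier by blast
  obtain T where T: "T \<subseteq> C" "finite T" "k \<sqsubseteq> \<Squnion>T" using k C le unfolding mt_compact_def by blast
  from \<open>finite T\<close> \<open>T \<subseteq> C\<close> have "\<exists>u\<in>C. \<forall>t\<in>T. t \<sqsubseteq> u"
  proof (induction T)
    case empty
    then show ?case using C by blast
  next
    case (insert t T)
    then obtain u where u: "u \<in> C" "\<forall>t\<in>T. t \<sqsubseteq> u" by auto
    have t: "t \<in> C" "T \<subseteq> carrier M" using insert.prems Cc by auto
    consider "t \<sqsubseteq> u" | "u \<sqsubseteq> t" using chain[OF t(1) u(1)] by blast
    then show ?case
    proof cases
      case 1
      then show ?thesis using u by auto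
    next
      case 2
      then have "\<forall>t'\<in>T. t' \<sqsubseteq> t" using u t Cc le_trans[of _ u t] by (simp add: subset_iff)
      then show ?thesis using t Cc by (auto intro!: bexI[of _ t])
    qed
  qed
  then obtain u where u: "u \<in> C" "\<forall>t\<in>T. t \<sqsubseteq> u" by blast
  have "\<Squnion>T \<sqsubseteq> u" using u T Cc by (subst sup_le_iff) auto
  moreover have "T \<subseteq> carrier M" "u \<in> carrier M" using T u Cc by auto
  ultimately have "k \<sqsubseteq> u" using T(3) compact_carrier[OF k] le_trans[of k "\<Squnion>T" u] by simp
  then show ?thesis using u by blast
qed

end

section \<open>Sober algebras and compact saturated elements\<close>

locale sober_mt_algebra = mt_algebra M for M :: "('a, 'm) mt_structure_scheme" (structure) +
  assumes sober: "mt_sober M"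
begin

lemma T0: "mt_T0 M"
  using sober by (simp add: mt_sober_def)

lemma irreducible_closed_atom:
  "mt_join_irreducible_closed M p \<Longrightarrow> \<exists>x\<in>mt_atoms M. p = mt_diamond M x"
  using sober by (simp add: mt_sober_def)

text \<open>Complements turn a prime open element into a join-irreducible closed one, which sobriety
  makes the closure of an atom \<open>x\<close>. An open element avoids \<open>x\<close> iff it
  avoids this closure, that is, iff it lies below \<open>p\<close>.\<close>

lemma prime_open_atom:
  assumes p: "p \<in> mt_opens M" "p \<noteq> \<top>"
    and prime: "\<And>a b. \<lbrakk>a \<in> mt_opens M; b \<in> mt_opens M; a \<sqinter> b \<sqsubseteq> p\<rbrakk> \<Longrightarrow> a \<sqsubseteq> p \<or> b \<sqsubseteq> p"
  shows "\<exists>x\<in>mt_atoms M. \<forall>u\<in>mt_opens M. x \<sqsubseteq> u \<longleftrightarrow> \<not> u \<sqsubseteq> p"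
proof -
  note pc = open_carrier[OF p(1)]
  have "mt_join_irreducible_closed M (mt_compl M p)"
    unfolding mt_join_irreducible_closed_def
  proof (intro conjI ballI impI)
    show "mt_compl M p \<in> mt_closeds M" using p by (simp add: compl_open_closed)
    show "mt_compl M p \<noteq> \<bottom>" using p pc compl_top by (metis compl_inj top_closed)
    fix a b assume ab: "a \<in> mt_closeds M" "b \<in> mt_closeds M" "mt_compl M p = a \<squnion> b"
    then have c: "a \<in> carrier M" "b \<in> carrier M" "mt_compl M a \<in> mt_opens M"
      "mt_compl M b \<in> mt_opens M" by (auto simp: closed_iff)
    let ?m = "mt_compl M a \<sqinter> mt_compl M b"
    have mc: "?m \<in> carrier M" using c by simp
    have "a \<sqsubseteq> mt_compl M ?m" "b \<sqsubseteq> mt_compl M ?m"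
      using compl_le_compl_iff[of "mt_compl M a" ?m] compl_le_compl_iff[of "mt_compl M b" ?m] c
      by (simp_all add: meet_left meet_right)
    then have "mt_compl M p \<sqsubseteq> mt_compl M ?m" using ab c mc by (simp add: join_le)
    then have "?m \<sqsubseteq> p" using pc mc by (simp add: compl_le_compl_iff)
    then have "mt_compl M a \<sqsubseteq> p \<or> mt_compl M b \<sqsubseteq> p" using prime c by blast
    then have "mt_compl M p \<sqsubseteq> a \<or> mt_compl M p \<sqsubseteq> b"
      using compl_le_compl_iff[of p "mt_compl M a"] compl_le_compl_iff[of p "mt_compl M b"] c pc
      by simp
    moreover have "a \<sqsubseteq> mt_compl M p" "b \<sqsubseteq> mt_compl M p"
      using ab c by (simp_all add: join_left join_right)
    ultimately show "mt_compl M p = a \<or> mt_compl M p = b"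
      using le_antisym c pc by auto
  qed
  then obtain x where x: "x \<in> mt_atoms M" "mt_compl M p = mt_diamond M x"
    using irreducible_closed_atom by blast
  have "x \<sqsubseteq> u \<longleftrightarrow> \<not> u \<sqsubseteq> p" if u: "u \<in> mt_opens M" for u
  proof -
    note uc = open_carrier[OF u]
    have "u \<sqsubseteq> p \<longleftrightarrow> mt_diamond M x \<sqsubseteq> mt_compl M u"
      using x uc pc compl_le_compl_iff[of p u] by simp
    also have "\<dots> \<longleftrightarrow> x \<sqsubseteq> mt_compl M u"
      using x u by (simp add: diamond_le_iff atom_carrier compl_open_closed)
    also have "\<dots> \<longleftrightarrow> \<not> x \<sqsubseteq> u" using x uc by (simp add: atom_le_compl_iff)
    finally show ?thesis by blast
  qed
  then show ?thesis using x by blast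
qed

lemma KS_le_open_iff:
  assumes k: "k \<in> mt_KS M" and w: "w \<in> mt_opens M"
  shows "k \<sqsubseteq> w \<longleftrightarrow> eta M k \<subseteq> eta M w"
proof
  assume "k \<sqsubseteq> w"
  then show "eta M k \<subseteq> eta M w"
    using k w eta_mono[of k w] by (simp add: open_carrier mt_KS_def compact_carrier)
next
  assume sub: "eta M k \<subseteq> eta M w"
  have kcomp: "mt_compact M k" and ksat: "mt_saturated M k" using k by (auto simp: mt_KS_def)
  note kc = compact_carrier[OF kcomp]
  show "k \<sqsubseteq> w"
  proof (rule ccontr)
    assume neg: "\<not> k \<sqsubseteq> w"
    define A where "A = {u \<in> mt_opens M. w \<sqsubseteq> u \<and> \<not> k \<sqsubseteq> u}"
    have wA: "w \<in> A" using neg w by (simp add: A_def open_carrier)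
    have Ao: "A \<subseteq> mt_opens M" and Ac: "A \<subseteq> carrier M" using opens_carrier by (auto simp: A_def)
    have "\<exists>p\<in>A. \<forall>a\<in>A. p \<sqsubseteq> a \<longrightarrow> a = p"
    proof (rule predicate_Zorn)
      show "partial_order_on A (relation_of (\<sqsubseteq>) A)"
        using Ac by (intro partial_order_on_relation_ofI) (auto intro: le_trans le_antisym)
      fix C assume "C \<in> Chains (relation_of (\<sqsubseteq>) A)"
      then have CA: "C \<subseteq> A" and chain: "\<And>u v. \<lbrakk>u \<in> C; v \<in> C\<rbrakk> \<Longrightarrow> u \<sqsubseteq> v \<or> v \<sqsubseteq> u"
        by (auto simp: Chains_def relation_of_def)
      show "\<exists>u\<in>A. \<forall>a\<in>C. a \<sqsubseteq> u"
      proof (cases "C = {}")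
        case True
        \<comment> \<open>The empty chain needs its own bound: its join is bottom, which need not
          lie above \<open>w\<close>.\<close>
        then show ?thesis using wA by blast
      next
        case False
        have Co: "C \<subseteq> mt_opens M" and Cc: "C \<subseteq> carrier M" using CA Ao Ac by auto
        then have sc: "\<Squnion>C \<in> carrier M" by simp
        have "\<not> k \<sqsubseteq> \<Squnion>C"
          using compact_chain_sup[OF kcomp Co False chain] CA by (auto simp: A_def)
        moreover obtain c where c: "c \<in> C" using False by blast
        then have "w \<sqsubseteq> \<Squnion>C"
          using CA Cc sc w sup_upper[OF Cc c] le_trans[of w c] by (auto simp: A_def open_carrier)
        ultimately have "\<Squnion>C \<in> A" using open_sup[OF Co] by (simp add: A_def)
        then show ?thesis using sup_upper[OF Cc] by blast
      qed
    qed
    then obtain p where p: "p \<in> A" and max: "\<And>a. \<lbrakk>a \<in> A; p \<sqsubseteq> a\<rbrakk> \<Longrightarrow> a = p" by blast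
    have po: "p \<in> mt_opens M" and pc: "p \<in> carrier M" and wp: "w \<sqsubseteq> p" and kp: "\<not> k \<sqsubseteq> p"
      using p Ac by (auto simp: A_def)
    \<comment> \<open>The element \<open>p \<squnion> a\<close> is open, above \<open>w\<close> and
      strictly above \<open>p\<close>. By maximality it is not in \<open>A\<close>, and lying above
      \<open>k\<close> is the only way left for it to fail.\<close>
    have join_above: "k \<sqsubseteq> p \<squnion> a" if a: "a \<in> mt_opens M" "\<not> a \<sqsubseteq> p" for a
    proof (rule ccontr)
      assume nk: "\<not> k \<sqsubseteq> p \<squnion> a"
      have ac: "a \<in> carrier M" using a open_carrier by simp
      have "p \<squnion> a \<in> mt_opens M"
        using open_sup[of "{p, a}"] po a by (simp add: join_def)
      moreover have "p \<sqsubseteq> p \<squnion> a" using pc ac by (simp add: join_left)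
      moreover have "w \<sqsubseteq> p \<squnion> a"
        using wp calculation(2) pc ac open_carrier[OF w] le_trans[of w p "p \<squnion> a"] by simp
      ultimately have "p \<squnion> a = p" using max nk by (simp add: A_def)
      then show False using a ac pc join_right[of p a] by simp
    qed
    have "\<exists>x\<in>mt_atoms M. \<forall>u\<in>mt_opens M. x \<sqsubseteq> u \<longleftrightarrow> \<not> u \<sqsubseteq> p"
    proof (rule prime_open_atom[OF po])
      show "p \<noteq> \<top>" using kp kc top_higher by blast
      fix a b assume ab: "a \<in> mt_opens M" "b \<in> mt_opens M" "a \<sqinter> b \<sqsubseteq> p"
      have c: "a \<in> carrier M" "b \<in> carrier M" using ab open_carrier by auto
      show "a \<sqsubseteq> p \<or> b \<sqsubseteq> p"
      proof (rule ccontr)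
        assume "\<not> (a \<sqsubseteq> p \<or> b \<sqsubseteq> p)"
        then have ka: "k \<sqsubseteq> p \<squnion> a" and kb: "k \<sqsubseteq> p \<squnion> b" using join_above ab by auto
        \<comment> \<open>Expanding this meet by distributivity leaves only terms below
          \<open>p\<close>: those containing a factor \<open>p\<close>, and
          \<open>a \<sqinter> b\<close> by assumption.\<close>
        have "k \<sqsubseteq> (p \<squnion> a) \<sqinter> (p \<squnion> b)" using ka kb kc c pc by (simp add: le_meet_iff)
        also have "(p \<squnion> a) \<sqinter> (p \<squnion> b) = ((p \<squnion> a) \<sqinter> p) \<squnion> ((p \<squnion> a) \<sqinter> b)"
          using c pc by (simp add: meet_join_distrib)
        finally have k1: "k \<sqsubseteq> ((p \<squnion> a) \<sqinter> p) \<squnion> ((p \<squnion> a) \<sqinter> b)" .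
        have "(p \<squnion> a) \<sqinter> b = (b \<sqinter> p) \<squnion> (a \<sqinter> b)"
          using c pc by (simp add: meet_commute[of _ b] meet_join_distrib)
        then have "(p \<squnion> a) \<sqinter> b \<sqsubseteq> p"
          using c pc ab by (simp add: join_le_iff meet_right)
        then have "((p \<squnion> a) \<sqinter> p) \<squnion> ((p \<squnion> a) \<sqinter> b) \<sqsubseteq> p"
          using c pc by (simp add: join_le_iff meet_right)
        then have "k \<sqsubseteq> p" using k1 kc c pc by (meson join_closed le_trans meet_closed)
        then show False using kp by simp
      qed
    qed
    then obtain x where x: "x \<in> mt_atoms M" "\<forall>u\<in>mt_opens M. x \<sqsubseteq> u \<longleftrightarrow> \<not> u \<sqsubseteq> p"
      by blast
    have "x \<sqsubseteq> u" if "u \<in> mt_opens M" "k \<sqsubseteq> u" for u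
    proof -
      have "\<not> u \<sqsubseteq> p" using that kp kc pc le_trans[of k u p] open_carrier[of u] by blast
      then show ?thesis using x that by blast
    qed
    then have "x \<sqsubseteq> k"
      using saturated_leI[OF ksat] atom_carrier[OF x(1)] by blast
    then have "x \<in> eta M w" using sub x(1) eta_eq[OF kc] by blast
    then have "x \<sqsubseteq> w" using eta_eq[OF open_carrier[OF w]] by blast
    then show False using x w wp by blast
  qed
qed

end

section \<open>Saturations and compact saturated sets of atoms\<close>

context mt_algebra
begin

lemma mt_compactD:
  "\<lbrakk>mt_compact M k; U \<subseteq> mt_opens M; k \<sqsubseteq> \<Squnion>U\<rbrakk> \<Longrightarrow> \<exists>T\<subseteq>U. finite T \<and> k \<sqsubseteq> \<Squnion>T"
  by (simp add: mt_compact_def)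

text \<open>Compactness depends only on which opens lie above an element, and passing from
  \<open>k\<close> to the meet of these opens does not change them. This is needed because
  \<open>mt_below\<close> supplies a compact element that need not be saturated, whereas
  \<open>eta_compact\<close> asks for membership in \<open>mt_KS M\<close>.\<close>

lemma saturation_least:
  assumes k: "mt_compact M k"
  defines "s \<equiv> \<Sqinter>{u \<in> mt_opens M. k \<sqsubseteq> u}"
  shows "s \<in> mt_KS M" "k \<sqsubseteq> s" "\<And>u. u \<in> mt_opens M \<Longrightarrow> s \<sqsubseteq> u \<longleftrightarrow> k \<sqsubseteq> u"
proof -
  note kc = compact_carrier[OF k]
  have S: "{u \<in> mt_opens M. k \<sqsubseteq> u} \<subseteq> carrier M" using opens_carrier by blast
  have sc: "s \<in> carrier M" unfolding s_def using S by (rule inf_closed)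
  show ks: "k \<sqsubseteq> s" unfolding s_def using S kc by (simp add: le_inf_iff)
  show *: "s \<sqsubseteq> u \<longleftrightarrow> k \<sqsubseteq> u" if u: "u \<in> mt_opens M" for u
  proof
    assume "s \<sqsubseteq> u"
    then show "k \<sqsubseteq> u" using ks kc sc u le_trans[of k s u] open_carrier by simp
  next
    assume "k \<sqsubseteq> u"
    then show "s \<sqsubseteq> u" unfolding s_def using S u by (intro inf_lower) auto
  qed
  have "mt_saturated M s" unfolding s_def by (rule saturated_inf) blast
  moreover have "mt_compact M s"
    unfolding mt_compact_def
  proof (intro conjI allI impI sc)
    fix U assume U: "U \<subseteq> mt_opens M" "s \<sqsubseteq> \<Squnion>U"
    then have "k \<sqsubseteq> \<Squnion>U" using * open_sup by simp
    then obtain T where T: "T \<subseteq> U" "finite T" "k \<sqsubseteq> \<Squnion>T" using mt_compactD[OF k U(1)] by blast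
    then have "s \<sqsubseteq> \<Squnion>T" using * U open_sup[of T] by simp
    then show "\<exists>T\<subseteq>U. finite T \<and> s \<sqsubseteq> \<Squnion>T" using T by blast
  qed
  ultimately show "s \<in> mt_KS M" by (simp add: mt_KS_def)
qed

lemma eta_saturated:
  assumes "mt_saturated M s"
  shows "saturatedin (at_obj M) (eta M s)"
proof -
  obtain S where S: "S \<subseteq> mt_opens M" "s = \<Sqinter>S"
    using assms unfolding mt_saturated_def by (elim exE conjE)
  then have "eta M s = topspace (at_obj M) \<inter> \<Inter>(eta M ` S)"
    by (simp add: eta_inf[OF subset_trans[OF _ opens_carrier]] topspace_at_obj)
  moreover have "eta M ` S \<subseteq> {U. openin (at_obj M) U}" using S by (auto simp: openin_at_obj)
  ultimately show ?thesis unfolding saturatedin_def by blast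
qed

end

context sober_mt_algebra
begin

text \<open>An open cover of \<open>eta M k\<close> is an inclusion into \<open>eta M\<close> of a
  single open join, so \<open>KS_le_open_iff\<close> lifts it to an inequality in \<open>M\<close>.
  The finite subfamily found there is mapped down again.\<close>

lemma eta_compact:
  assumes k: "k \<in> mt_KS M"
  shows "compactin (at_obj M) (eta M k)"
  unfolding compactin_def
proof (intro conjI allI impI)
  have kc: "k \<in> carrier M" using k by (simp add: mt_KS_def compact_carrier)
  then show "eta M k \<subseteq> topspace (at_obj M)" by (simp add: topspace_at_obj eta_subset_atoms)
  fix \<U> assume \<U>: "Ball \<U> (openin (at_obj M)) \<and> eta M k \<subseteq> \<Union>\<U>"
  then have "\<forall>U\<in>\<U>. \<exists>u. u \<in> mt_opens M \<and> U = eta M u" by (auto simp: openin_at_obj)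
  then obtain g where g: "\<And>U. U \<in> \<U> \<Longrightarrow> g U \<in> mt_opens M \<and> U = eta M (g U)" by metis
  have G: "g ` \<U> \<subseteq> mt_opens M" using g by blast
  have "eta M (\<Squnion>(g ` \<U>)) = \<Union>(eta M ` g ` \<U>)" using G opens_carrier by (intro eta_sup) blast
  also have "eta M ` g ` \<U> = \<U>" using g by (force simp: image_image)
  finally have "k \<sqsubseteq> \<Squnion>(g ` \<U>)" using \<U> KS_le_open_iff[OF k open_sup[OF G]] by simp
  then obtain T where T: "T \<subseteq> g ` \<U>" "finite T" "k \<sqsubseteq> \<Squnion>T"
    using mt_compactD[OF _ G] k by (auto simp: mt_KS_def)
  obtain \<F> where F: "\<F> \<subseteq> \<U>" "finite \<F>" "T = g ` \<F>"
    using finite_subset_image[OF T(2,1)] by blast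
  have To: "T \<subseteq> mt_opens M" using T G by blast
  have "eta M k \<subseteq> eta M (\<Squnion>T)" using KS_le_open_iff[OF k open_sup[OF To]] T by simp
  also have "\<dots> = \<Union>(eta M ` T)" using To opens_carrier by (intro eta_sup) blast
  also have "eta M ` T = \<F>" using g F by (force simp: image_image)
  finally show "\<exists>\<F>. finite \<F> \<and> \<F> \<subseteq> \<U> \<and> eta M k \<subseteq> \<Union>\<F>" using F by blast
qed

text \<open>Taking \<open>k\<close> to be the meet of all opens \<open>u\<close> with \<open>K \<subseteq> \<eta>(u)\<close>, rather than of some family of opens
  witnessing that \<open>K\<close> is saturated, is what makes \<open>k\<close> compact when \<open>M\<close> is not spatial.\<close>

lemma compact_saturated_eq_eta:
  assumes K: "compactin (at_obj M) K" and sat: "saturatedin (at_obj M) K"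
  obtains k where "k \<in> mt_KS M" "K = eta M k"
proof -
  let ?S = "{u \<in> mt_opens M. K \<subseteq> eta M u}"
  define k where "k = \<Sqinter>?S"
  have S: "?S \<subseteq> carrier M" using opens_carrier by blast
  have kc: "k \<in> carrier M" unfolding k_def using S by (rule inf_closed)
  have Ka: "K \<subseteq> mt_atoms M" using compactin_subset_topspace[OF K] by (simp add: topspace_at_obj)
  have eta_k: "eta M k = mt_atoms M \<inter> \<Inter>(eta M ` ?S)" unfolding k_def using S by (rule eta_inf)
  have "K = eta M k"
  proof
    show "K \<subseteq> eta M k" using Ka eta_k by blast
    obtain \<U> where \<U>: "\<U> \<subseteq> {U. openin (at_obj M) U}" "K = mt_atoms M \<inter> \<Inter>\<U>"
      using sat by (auto simp: saturatedin_def topspace_at_obj)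
    \<comment> \<open>Any family witnessing that \<open>K\<close> is saturated consists of open sets
      containing \<open>K\<close>, so it is among the sets met in forming
      \<open>eta M k\<close>.\<close>
    have "\<U> \<subseteq> eta M ` ?S"
    proof
      fix U assume U: "U \<in> \<U>"
      then obtain u where "u \<in> mt_opens M" "U = eta M u" using \<U>(1) by (auto simp: openin_at_obj)
      then show "U \<in> eta M ` ?S" using U \<U>(2) by blast
    qed
    then show "eta M k \<subseteq> K" unfolding eta_k \<U>(2) by blast
  qed
  moreover have "mt_saturated M k" unfolding k_def by (rule saturated_inf) blast
  moreover have "mt_compact M k"
    unfolding mt_compact_def
  proof (intro conjI allI impI kc)
    fix U assume U: "U \<subseteq> mt_opens M" "k \<sqsubseteq> \<Squnion>U"
    have "K \<subseteq> eta M (\<Squnion>U)"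
      using \<open>K = eta M k\<close> eta_mono[OF kc open_carrier[OF open_sup[OF U(1)]] U(2)] by simp
    also have "\<dots> = \<Union>(eta M ` U)" using U(1) opens_carrier by (intro eta_sup) blast
    finally obtain \<F> where F: "finite \<F>" "\<F> \<subseteq> eta M ` U" "K \<subseteq> \<Union>\<F>"
      using compactinD[OF K, of "eta M ` U"] U(1) by (auto simp: openin_at_obj)
    obtain T where T: "T \<subseteq> U" "finite T" "\<F> = eta M ` T"
      using finite_subset_image[OF F(1,2)] by blast
    have To: "T \<subseteq> mt_opens M" using T U by blast
    then have "\<Union>\<F> = eta M (\<Squnion>T)" using T opens_carrier eta_sup[of T] by simp
    \<comment> \<open>A finite subcover of \<open>K\<close> gives an open element whose atoms
      include \<open>K\<close>; this is one of the elements met to form \<open>k\<close>. The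
      inequality in \<open>M\<close> therefore needs no reflection of order by
      \<open>eta\<close>.\<close>
    then have "\<Squnion>T \<in> ?S" using F open_sup[OF To] by simp
    then have "k \<sqsubseteq> \<Squnion>T" unfolding k_def using S by (intro inf_lower)
    then show "\<exists>T\<subseteq>U. finite T \<and> k \<sqsubseteq> \<Squnion>T" using T by blast
  qed
  ultimately show thesis using that by (simp add: mt_KS_def)
qed

section \<open>Sobriety and local compactness of the space of atoms\<close>

text \<open>Different closed elements may have the same set of atoms, so irreducibility of
  \<open>C\<close> only carries over to the least closed element whose set of atoms is \<open>C\<close>.\<close>

lemma sober_space_at_obj: "sober_space (at_obj M)"
  unfolding sober_space_def
proof (intro allI impI)
  fix C assume C: "irreducible_closedin (at_obj M) C"
  then have Ccl: "closedin (at_obj M) C" and C0: "C \<noteq> {}" by (auto simp: irreducible_closedin_def)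
  have Ca: "C \<subseteq> mt_atoms M" using closedin_subset[OF Ccl] by (simp add: topspace_at_obj)
  then have Cc: "C \<subseteq> carrier M" using atom_carrier by blast
  define p where "p = mt_diamond M (\<Squnion>C)"
  have pcl: "p \<in> mt_closeds M" using Cc by (simp add: p_def diamond_closed)
  note pc = closed_carrier[OF pcl]
  have eta_p: "eta M p = C"
    using closure_of_at_obj[OF Ca] closure_of_closedin[OF Ccl] by (simp add: p_def)
  have p_le: "p \<sqsubseteq> c" if "c \<in> mt_closeds M" "C \<subseteq> eta M c" for c
    using that Cc unfolding p_def
    by (simp add: diamond_le_iff sup_le_iff closed_carrier) (auto simp: eta_eq closed_carrier)
  have "mt_join_irreducible_closed M p"
    unfolding mt_join_irreducible_closed_def
  proof (intro conjI ballI impI pcl)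
    show "p \<noteq> \<bottom>" using eta_p C0 atom_not_le_bot by (auto simp: eta_eq)
    fix a b assume ab: "a \<in> mt_closeds M" "b \<in> mt_closeds M" "p = a \<squnion> b"
    then have c: "a \<in> carrier M" "b \<in> carrier M" by (auto simp: closed_carrier)
    then have "C = eta M a \<union> eta M b" using eta_p ab by (simp add: eta_join)
    then have "C = eta M a \<or> C = eta M b"
      using C ab unfolding irreducible_closedin_def closedin_at_obj by blast
    then have "p \<sqsubseteq> a \<or> p \<sqsubseteq> b" using p_le ab by auto
    moreover have "a \<sqsubseteq> p" "b \<sqsubseteq> p" using ab c by (simp_all add: join_left join_right)
    ultimately show "p = a \<or> p = b" using le_antisym c pc by auto
  qed
  then obtain x where x: "x \<in> mt_atoms M" "p = mt_diamond M x"
    using irreducible_closed_atom by blast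
  have cl: "at_obj M closure_of {y} = eta M (mt_diamond M y)" if "y \<in> mt_atoms M" for y
    using closure_of_at_obj[of "{y}"] that by (simp add: atom_carrier)
  show "\<exists>!x. x \<in> topspace (at_obj M) \<and> C = at_obj M closure_of {x}"
  proof (rule ex1I[of _ x])
    show "x \<in> topspace (at_obj M) \<and> C = at_obj M closure_of {x}"
      using x eta_p by (simp add: topspace_at_obj cl)
    fix y assume "y \<in> topspace (at_obj M) \<and> C = at_obj M closure_of {y}"
    then have y: "y \<in> mt_atoms M" and eq: "eta M (mt_diamond M y) = eta M (mt_diamond M x)"
      using x eta_p by (simp_all add: topspace_at_obj cl)
    note c = atom_carrier[OF x(1)] atom_carrier[OF y]
    \<comment> \<open>So far only the sets of atoms of the two closures agree. Each atom lies below
      its own closure and thus below the other one; minimality of the diamond upgrades this to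
      equality of the closed elements, and so to agreement of \<open>x\<close> and \<open>y\<close>
      on all opens.\<close>
    have "x \<in> eta M (mt_diamond M x)" "y \<in> eta M (mt_diamond M y)"
      using x y c by (simp_all add: eta_eq diamond_carrier le_diamond)
    then have "x \<sqsubseteq> mt_diamond M y" "y \<sqsubseteq> mt_diamond M x"
      using eq eta_eq[OF diamond_carrier[OF c(1)]] eta_eq[OF diamond_carrier[OF c(2)]] by auto
    then have le: "mt_diamond M x \<sqsubseteq> mt_diamond M y" "mt_diamond M y \<sqsubseteq> mt_diamond M x"
      using c by (simp_all add: diamond_le_iff diamond_closed)
    have "mt_diamond M x = mt_diamond M y"
      using le c by (intro le_antisym) (simp_all add: diamond_carrier)
    then have "x \<sqsubseteq> d \<longleftrightarrow> y \<sqsubseteq> d" if "d \<in> mt_closeds M" for d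
      using that c diamond_le_iff by metis
    then have "x \<sqsubseteq> u \<longleftrightarrow> y \<sqsubseteq> u" if "u \<in> mt_opens M" for u
      using that compl_open_closed[OF that] atom_le_compl_iff[OF x(1) open_carrier[OF that]]
        atom_le_compl_iff[OF y open_carrier[OF that]] by blast
    then show "y = x" using T0_atom_eqI[OF T0 x(1) y] by simp
  qed
qed

text \<open>Join-primeness of the atom selects one open \<open>v\<close> from the join that
  represents \<open>u\<close>. The saturation \<open>s\<close> of the interpolating compact element
  stays below \<open>u\<close> because \<open>u\<close> is open, and \<open>eta M s\<close> is the
  required compact neighbourhood.\<close>

lemma locally_compact_at_obj:
  assumes lc: "mt_locally_compact M"
  shows "locally_compact_base (at_obj M)"
  unfolding locally_compact_base_def neighbourhood_base_of
proof (intro allI impI)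
  fix W x assume "openin (at_obj M) W \<and> x \<in> W"
  then obtain u where u: "u \<in> mt_opens M" "W = eta M u" "x \<in> eta M u" by (auto simp: openin_at_obj)
  note uc = open_carrier[OF u(1)]
  let ?V = "{v \<in> mt_opens M. mt_below M v u}"
  have x: "x \<in> mt_atoms M" "x \<sqsubseteq> u" using u uc by (auto simp: eta_eq)
  have V: "?V \<subseteq> carrier M" using opens_carrier by blast
  have "u = \<Squnion>?V" using lc u(1) unfolding mt_locally_compact_def by (rule bspec)
  then have "x \<sqsubseteq> \<Squnion>?V" by (rule subst) (rule x(2))
  then obtain v where v: "v \<in> ?V" "x \<sqsubseteq> v" using atom_le_sup[OF x(1) V] by blast
  then obtain k where k: "mt_compact M k" "v \<sqsubseteq> k" "k \<sqsubseteq> u" by (auto simp: mt_below_def)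
  define s where "s = \<Sqinter>{u \<in> mt_opens M. k \<sqsubseteq> u}"
  note s = saturation_least[OF k(1), folded s_def]
  have c: "v \<in> carrier M" "k \<in> carrier M" "s \<in> carrier M"
    using v k s(1) by (auto simp: open_carrier compact_carrier mt_KS_def)
  have "v \<sqsubseteq> s" using k(2) s(2) c le_trans[of v k s] by simp
  then have "eta M v \<subseteq> eta M s" using c by (simp add: eta_mono)
  moreover have "eta M s \<subseteq> eta M u" using s(3)[OF u(1)] k(3) c uc by (simp add: eta_mono)
  moreover have "x \<in> eta M v" using v x c by (simp add: eta_eq)
  moreover have "openin (at_obj M) (eta M v)" using v by (auto simp: openin_at_obj)
  ultimately show "\<exists>U V. openin (at_obj M) U \<and> compactin (at_obj M) V \<and> x \<in> U \<and> U \<subseteq> V \<and> V \<subseteq> W"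
    using eta_compact[OF s(1)] u(2) by blast
qed

end

lemma at_obj_LCSob: "M \<in> LCSobMT \<Longrightarrow> at_obj M \<in> LCSob"
  unfolding LCSobMT_def LCSob_def
  using sober_mt_algebra.sober_space_at_obj sober_mt_algebra.locally_compact_at_obj
  by (auto simp: sober_mt_algebra_def sober_mt_algebra_axioms_def)

section \<open>Powerset algebras\<close>

lemma carrier_P_obj [simp]: "carrier (P_obj X) = Pow (topspace X)"
  and le_P_obj [simp]: "le (P_obj X) = (\<subseteq>)"
  and box_P_obj [simp]: "mt_box (P_obj X) = (interior_of) X"
  by (simp_all add: P_obj_def)

lemma sup_P_obj:
  assumes "S \<subseteq> Pow (topspace X)"
  shows "\<Squnion>\<^bsub>P_obj X\<^esub> S = \<Union>S"
proof -
  interpret mt_algebra "P_obj X" by (rule mt_algebra_P_obj)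
  have S: "S \<subseteq> carrier (P_obj X)" using assms by simp
  show ?thesis
    using sup_least[OF S, of "\<Union>S"] sup_upper[OF S] assms by (simp only: le_P_obj) force
qed

text \<open>The factor \<open>topspace X\<close> is the value of the empty meet; it matches the form
  of \<open>saturatedin\<close>.\<close>

lemma inf_P_obj:
  assumes "S \<subseteq> Pow (topspace X)"
  shows "\<Sqinter>\<^bsub>P_obj X\<^esub> S = topspace X \<inter> \<Inter>S"
proof -
  interpret mt_algebra "P_obj X" by (rule mt_algebra_P_obj)
  have S: "S \<subseteq> carrier (P_obj X)" using assms by simp
  show ?thesis
    using inf_greatest[OF S, of "topspace X \<inter> \<Inter>S"] inf_lower[OF S] inf_closed[OF S]
    by (simp only: le_P_obj) force
qed

lemma join_P_obj: "\<lbrakk>A \<subseteq> topspace X; B \<subseteq> topspace X\<rbrakk> \<Longrightarrow> A \<squnion>\<^bsub>P_obj X\<^esub> B = A \<union> B"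
  by (simp add: join_def sup_P_obj)

lemma meet_P_obj: "\<lbrakk>A \<subseteq> topspace X; B \<subseteq> topspace X\<rbrakk> \<Longrightarrow> A \<sqinter>\<^bsub>P_obj X\<^esub> B = A \<inter> B"
  by (auto simp: meet_def inf_P_obj)

lemma bottom_P_obj: "\<bottom>\<^bsub>P_obj X\<^esub> = {}"
proof -
  interpret mt_algebra "P_obj X" by (rule mt_algebra_P_obj)
  show ?thesis using bottom_lower[of "{}"] by simp
qed

lemma top_P_obj: "\<top>\<^bsub>P_obj X\<^esub> = topspace X"
proof -
  interpret mt_algebra "P_obj X" by (rule mt_algebra_P_obj)
  show ?thesis using top_higher[of "topspace X"] top_closed by auto
qed

lemma compl_P_obj:
  assumes "A \<subseteq> topspace X"
  shows "mt_compl (P_obj X) A = topspace X - A"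
proof -
  interpret mt_algebra "P_obj X" by (rule mt_algebra_P_obj)
  show ?thesis
    using assms by (intro compl_eqI) (auto simp: meet_P_obj join_P_obj bottom_P_obj top_P_obj)
qed

lemma opens_P_obj: "mt_opens (P_obj X) = {U. openin X U}"
  using openin_subset by (fastforce simp: mt_opens_def interior_of_eq eq_commute[of _ "X interior_of _"])

lemma diamond_P_obj: "A \<subseteq> topspace X \<Longrightarrow> mt_diamond (P_obj X) A = X closure_of A"
  by (simp add: mt_diamond_def compl_P_obj closure_of_interior_of interior_of_subset_topspace)

lemma closeds_P_obj: "mt_closeds (P_obj X) = {C. closedin X C}"
proof -
  interpret mt_algebra "P_obj X" by (rule mt_algebra_P_obj)
  show ?thesis by (auto simp: closed_iff opens_P_obj compl_P_obj closedin_def)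
qed

lemma saturated_P_obj: "mt_saturated (P_obj X) K \<longleftrightarrow> saturatedin X K"
proof -
  have "\<Sqinter>\<^bsub>P_obj X\<^esub> \<U> = topspace X \<inter> \<Inter>\<U>" if "\<U> \<subseteq> {U. openin X U}" for \<U>
    using that openin_subset by (intro inf_P_obj) blast
  then show ?thesis
    unfolding mt_saturated_def saturatedin_def opens_P_obj by (simp cong: conj_cong)
qed

lemma compact_P_obj: "mt_compact (P_obj X) K \<longleftrightarrow> compactin X K"
proof -
  have *: "\<U> \<subseteq> Pow (topspace X)" if "\<U> \<subseteq> {U. openin X U}" for \<U>
    using that by (auto dest!: subsetD openin_subset)
  have eq: "(K \<subseteq> \<Squnion>\<^bsub>P_obj X\<^esub> \<U> \<longrightarrow> (\<exists>T\<subseteq>\<U>. finite T \<and> K \<subseteq> \<Squnion>\<^bsub>P_obj X\<^esub> T)) \<longleftrightarrow>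
    (K \<subseteq> \<Union>\<U> \<longrightarrow> (\<exists>T\<subseteq>\<U>. finite T \<and> K \<subseteq> \<Union>T))" if "\<U> \<subseteq> {U. openin X U}" for \<U>
  proof -
    have "\<Squnion>\<^bsub>P_obj X\<^esub> T = \<Union>T" if "T \<subseteq> \<U>" for T
      by (rule sup_P_obj[OF subset_trans[OF that *[OF \<open>\<U> \<subseteq> {U. openin X U}\<close>]]])
    then show ?thesis by (simp cong: conj_cong)
  qed
  show ?thesis
    unfolding mt_compact_def opens_P_obj le_P_obj carrier_P_obj Pow_iff compactin_def Ball_Collect
    by (simp add: eq cong: imp_cong) blast
qed

lemma below_P_obj: "mt_below (P_obj X) A B \<longleftrightarrow> (\<exists>K. compactin X K \<and> A \<subseteq> K \<and> K \<subseteq> B)"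
  by (simp add: mt_below_def compact_P_obj)

lemma KS_P_obj: "mt_KS (P_obj X) = {K. compactin X K \<and> saturatedin X K}"
  by (simp add: mt_KS_def compact_P_obj saturated_P_obj)

section \<open>Atoms, sobriety and local compactness of powerset algebras\<close>

lemma atoms_P_obj: "mt_atoms (P_obj X) = (\<lambda>x. {x}) ` topspace X"
proof
  show "mt_atoms (P_obj X) \<subseteq> (\<lambda>x. {x}) ` topspace X"
  proof
    fix A assume "A \<in> mt_atoms (P_obj X)"
    then have A: "A \<subseteq> topspace X" "A \<noteq> {}" "\<And>B. B \<subseteq> A \<Longrightarrow> B \<subseteq> topspace X \<Longrightarrow> B = {} \<or> B = A"
      by (auto simp: mt_atoms_def bottom_P_obj)
    then obtain x where x: "x \<in> A" by blast
    then have "{x} = A" using A(1) A(3)[of "{x}"] by auto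
    then show "A \<in> (\<lambda>x. {x}) ` topspace X" using x A by blast
  qed
  show "(\<lambda>x. {x}) ` topspace X \<subseteq> mt_atoms (P_obj X)"
    by (auto simp: mt_atoms_def bottom_P_obj)
qed

lemma eta_P_obj: "A \<subseteq> topspace X \<Longrightarrow> eta (P_obj X) A = (\<lambda>x. {x}) ` A"
  by (auto simp: eta_def atoms_P_obj)

lemma topspace_at_P_obj: "topspace (at_obj (P_obj X)) = (\<lambda>x. {x}) ` topspace X"
  using mt_algebra.topspace_at_obj[OF mt_algebra_P_obj] by (simp add: atoms_P_obj)

text \<open>The closure of a point is irreducible, since any closed set containing the point
  contains its closure. The uniqueness half of sobriety then applies.\<close>

lemma sober_space_closure_inj:
  assumes "sober_space X" "x \<in> topspace X" "y \<in> topspace X"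
    and eq: "X closure_of {x} = X closure_of {y}"
  shows "x = y"
proof -
  have "irreducible_closedin X (X closure_of {x})"
    unfolding irreducible_closedin_def
  proof (intro conjI allI impI)
    show "X closure_of {x} \<noteq> {}" using assms(2) by (simp add: closure_of_eq_empty_gen)
    fix A B assume AB: "closedin X A \<and> closedin X B \<and> X closure_of {x} = A \<union> B"
    then have "x \<in> A \<union> B" using assms(2) closure_of_subset[of "{x}" X] by auto
    then have "X closure_of {x} \<subseteq> A \<or> X closure_of {x} \<subseteq> B"
      using AB closure_of_minimal[of "{x}"] by auto
    then show "X closure_of {x} = A \<or> X closure_of {x} = B" using AB by blast
  qed simp
  then show ?thesis using assms unfolding sober_space_def by blast
qed

text \<open>Each singleton is weakly locally closed, being the saturation of its point intersected
  with the closure: a point in both has the same closure as \<open>x\<close>. Every set is a union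
  of singletons.\<close>

lemma T0_P_obj:
  assumes "sober_space X"
  shows "mt_T0 (P_obj X)"
  unfolding mt_T0_def
proof
  interpret mt_algebra "P_obj X" by (rule mt_algebra_P_obj)
  fix A assume "A \<in> carrier (P_obj X)"
  then have A: "A \<subseteq> topspace X" by simp
  have "mt_weakly_locally_closed (P_obj X) {x}" if x: "x \<in> topspace X" for x
  proof -
    let ?s = "topspace X \<inter> \<Inter>{U. openin X U \<and> x \<in> U}"
    have "mt_saturated (P_obj X) ?s"
      unfolding saturated_P_obj saturatedin_def by (intro exI[of _ "{U. openin X U \<and> x \<in> U}"]) auto
    moreover have "X closure_of {x} \<in> mt_closeds (P_obj X)" by (simp add: closeds_P_obj)
    moreover have "{x} = ?s \<sqinter>\<^bsub>P_obj X\<^esub> (X closure_of {x})"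
    proof -
      have "y = x" if y: "y \<in> ?s" "y \<in> X closure_of {x}" for y
      proof -
        have "x \<in> X closure_of {y}" using y x by (auto simp: in_closure_of)
        then have "X closure_of {x} \<subseteq> X closure_of {y}" by (simp add: closure_of_minimal)
        moreover have "X closure_of {y} \<subseteq> X closure_of {x}" using y by (simp add: closure_of_minimal)
        ultimately show ?thesis using sober_space_closure_inj[OF assms _ x] y by blast
      qed
      moreover have "x \<in> ?s" using x by blast
      moreover have "x \<in> X closure_of {x}" using x closure_of_subset[of "{x}" X] by auto
      ultimately have "{x} = ?s \<inter> (X closure_of {x})" by blast
      then show ?thesis by (simp add: meet_P_obj closure_of_subset_topspace)
    qed
    ultimately show ?thesis unfolding mt_weakly_locally_closed_def by blast
  qed
  then have "(\<lambda>x. {x}) ` A \<subseteq> {w. mt_weakly_locally_closed (P_obj X) w}" using A by blast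
  moreover have "A = \<Squnion>\<^bsub>P_obj X\<^esub> ((\<lambda>x. {x}) ` A)" using A by (subst sup_P_obj) auto
  ultimately show "\<exists>S\<subseteq>{w. mt_weakly_locally_closed (P_obj X) w}. A = \<Squnion>\<^bsub>P_obj X\<^esub> S" by blast
qed

lemma sober_P_obj:
  assumes "sober_space X"
  shows "mt_sober (P_obj X)"
  unfolding mt_sober_def
proof (intro conjI allI impI T0_P_obj[OF assms])
  fix p assume p: "mt_join_irreducible_closed (P_obj X) p"
  then have "irreducible_closedin X p"
    by (auto simp: mt_join_irreducible_closed_def irreducible_closedin_def closeds_P_obj
        bottom_P_obj join_P_obj closedin_subset)
  then obtain x where "x \<in> topspace X" "p = X closure_of {x}"
    using assms unfolding sober_space_def by blast
  then show "\<exists>x\<in>mt_atoms (P_obj X). p = mt_diamond (P_obj X) x"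
    by (auto simp: atoms_P_obj diamond_P_obj)
qed

lemma locally_compact_P_obj:
  assumes "locally_compact_base X"
  shows "mt_locally_compact (P_obj X)"
  unfolding mt_locally_compact_def opens_P_obj
proof
  fix U assume "U \<in> {U. openin X U}"
  then have U: "openin X U" by simp
  let ?V = "{V \<in> {U. openin X U}. mt_below (P_obj X) V U}"
  have "?V \<subseteq> Pow (topspace X)" using openin_subset by blast
  then have "\<Squnion>\<^bsub>P_obj X\<^esub> ?V = \<Union>?V" by (rule sup_P_obj)
  moreover have "\<Union>?V = U"
  proof
    show "\<Union>?V \<subseteq> U"
    proof (rule Union_least)
      fix V assume "V \<in> ?V"
      then obtain K where "V \<subseteq> K" "K \<subseteq> U" unfolding below_P_obj by blast
      then show "V \<subseteq> U" by (rule subset_trans)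
    qed
    show "U \<subseteq> \<Union>?V"
    proof
      fix x assume x: "x \<in> U"
      have "\<exists>V K. openin X V \<and> compactin X K \<and> x \<in> V \<and> V \<subseteq> K \<and> K \<subseteq> U"
        using assms U x by (simp add: locally_compact_base_def neighbourhood_base_of)
      then obtain V where "V \<in> ?V" "x \<in> V" unfolding below_P_obj by blast
      then show "x \<in> \<Union>?V" by (rule UnionI)
    qed
  qed
  ultimately show "U = \<Squnion>\<^bsub>P_obj X\<^esub> ?V" by simp
qed

lemma P_obj_LCSobMT: "X \<in> LCSob \<Longrightarrow> P_obj X \<in> LCSobMT"
  by (simp add: LCSob_def LCSobMT_def mt_algebra_P_obj sober_P_obj locally_compact_P_obj)

lemma spatial_P_obj: "mt_spatial (P_obj X)"
  by (auto simp: mt_spatial_def atoms_P_obj bottom_P_obj)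

lemma (in mt_algebra) sup_empty: "\<Squnion>{} = \<bottom>"
  using sup_le_iff[of "{}" \<bottom>] le_bot_iff[of "\<Squnion>{}"] by simp

section \<open>Morphisms\<close>

locale mt_hom = M: mt_algebra M + N: mt_algebra N
  for M :: "('a, 'm) mt_structure_scheme" and N :: "('b, 'n) mt_structure_scheme" +
  fixes f
  assumes hom: "f \<in> mt_morphisms M N"
begin

lemma map_carrier: "a \<in> carrier M \<Longrightarrow> f a \<in> carrier N"
  and map_sup: "S \<subseteq> carrier M \<Longrightarrow> f (\<Squnion>\<^bsub>M\<^esub> S) = \<Squnion>\<^bsub>N\<^esub> (f ` S)"
  and map_inf: "S \<subseteq> carrier M \<Longrightarrow> f (\<Sqinter>\<^bsub>M\<^esub> S) = \<Sqinter>\<^bsub>N\<^esub> (f ` S)"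
  and map_compl: "a \<in> carrier M \<Longrightarrow> f (mt_compl M a) = mt_compl N (f a)"
  and map_box: "a \<in> carrier M \<Longrightarrow> f (mt_box M a) \<sqsubseteq>\<^bsub>N\<^esub> mt_box N (f a)"
  using hom by (auto simp: mt_morphisms_def)

lemma map_mono:
  assumes "a \<in> carrier M" "b \<in> carrier M" "a \<sqsubseteq>\<^bsub>M\<^esub> b"
  shows "f a \<sqsubseteq>\<^bsub>N\<^esub> f b"
proof -
  have "f (a \<sqinter>\<^bsub>M\<^esub> b) = f a \<sqinter>\<^bsub>N\<^esub> f b"
    using map_inf[of "{a, b}"] assms by (simp add: meet_def)
  then show ?thesis
    using M.meet_absorb[OF assms] N.meet_right[of "f a" "f b"] assms map_carrier by simp
qed

lemma map_bottom: "f \<bottom>\<^bsub>M\<^esub> = \<bottom>\<^bsub>N\<^esub>"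
  using map_sup[of "{}"] by (simp add: M.sup_empty N.sup_empty)

lemma map_open:
  assumes "u \<in> mt_opens M"
  shows "f u \<in> mt_opens N"
  using assms map_box[of u] map_carrier[of u] by (intro N.openI) (auto simp: mt_opens_def)

lemma at_map_carrier:
  assumes "x \<in> mt_atoms N"
  shows "at_map M N f x \<in> carrier M"
  using assms M.inf_closed[of "{a \<in> carrier M. x \<sqsubseteq>\<^bsub>N\<^esub> f a}"] by (auto simp: at_map_def)

text \<open>The meet defining \<open>at_map M N f x\<close> is preserved by \<open>f\<close>, so it
  belongs to the family over which it is taken. This is the adjunction between \<open>f\<close> and
  its left adjoint, with atoms on the left.\<close>

lemma at_map_le_iff:
  assumes x: "x \<in> mt_atoms N" and a: "a \<in> carrier M"
  shows "at_map M N f x \<sqsubseteq>\<^bsub>M\<^esub> a \<longleftrightarrow> x \<sqsubseteq>\<^bsub>N\<^esub> f a"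
proof
  let ?S = "{a \<in> carrier M. x \<sqsubseteq>\<^bsub>N\<^esub> f a}"
  have S: "?S \<subseteq> carrier M" by blast
  have y: "at_map M N f x = \<Sqinter>\<^bsub>M\<^esub> ?S" using x by (simp add: at_map_def)
  have yc: "at_map M N f x \<in> carrier M" using x by (rule at_map_carrier)
  note xc = N.atom_carrier[OF x]
  { assume "x \<sqsubseteq>\<^bsub>N\<^esub> f a"
    then show "at_map M N f x \<sqsubseteq>\<^bsub>M\<^esub> a" unfolding y using a by (intro M.inf_lower[OF S]) simp }
  have "f ` ?S \<subseteq> carrier N" using map_carrier by blast
  then have "x \<sqsubseteq>\<^bsub>N\<^esub> \<Sqinter>\<^bsub>N\<^esub> (f ` ?S)" using xc by (intro N.inf_greatest) auto
  then have *: "x \<sqsubseteq>\<^bsub>N\<^esub> f (at_map M N f x)" unfolding y map_inf[OF S] .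
  assume "at_map M N f x \<sqsubseteq>\<^bsub>M\<^esub> a"
  then have "f (at_map M N f x) \<sqsubseteq>\<^bsub>N\<^esub> f a" using map_mono yc a by blast
  then show "x \<sqsubseteq>\<^bsub>N\<^esub> f a" using N.le_trans[OF *] xc yc a map_carrier by simp
qed

text \<open>For \<open>z\<close> below the image, \<open>x\<close> lies below \<open>f z\<close> or
  below the complement of \<open>f z\<close>, which is \<open>f\<close> of the complement of
  \<open>z\<close>. By adjunction the first case makes \<open>z\<close> the whole image, and the
  second puts \<open>z\<close> below its own complement.\<close>

lemma at_map_atom:
  assumes x: "x \<in> mt_atoms N"
  shows "at_map M N f x \<in> mt_atoms M"
proof -
  let ?y = "at_map M N f x"
  have yc: "?y \<in> carrier M" using x by (rule at_map_carrier)
  have "\<not> ?y \<sqsubseteq>\<^bsub>M\<^esub> \<bottom>\<^bsub>M\<^esub>"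
    using x by (simp add: at_map_le_iff map_bottom N.atom_not_le_bot)
  then have "?y \<noteq> \<bottom>\<^bsub>M\<^esub>" by auto
  moreover have "z = \<bottom>\<^bsub>M\<^esub> \<or> z = ?y" if z: "z \<in> carrier M" "z \<sqsubseteq>\<^bsub>M\<^esub> ?y" for z
  proof (cases "x \<sqsubseteq>\<^bsub>N\<^esub> f z")
    case True
    then have "?y \<sqsubseteq>\<^bsub>M\<^esub> z" using x z by (simp add: at_map_le_iff)
    then show ?thesis using z yc M.le_antisym by blast
  next
    case False
    then have "x \<sqsubseteq>\<^bsub>N\<^esub> f (mt_compl M z)"
      using x z map_carrier by (simp add: map_compl N.atom_le_compl_iff)
    then have "?y \<sqsubseteq>\<^bsub>M\<^esub> mt_compl M z" using x z by (simp add: at_map_le_iff)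
    then have "z \<sqsubseteq>\<^bsub>M\<^esub> mt_compl M z" using z yc M.le_trans[of z ?y "mt_compl M z"] by simp
    then have "z \<sqinter>\<^bsub>M\<^esub> z = \<bottom>\<^bsub>M\<^esub>" using z by (simp add: M.le_compl_iff)
    then show ?thesis using z M.meet_absorb[of z z] by simp
  qed
  ultimately show ?thesis using yc by (simp add: mt_atoms_def)
qed

text \<open>Comparable atoms are equal, so a single inequality determines a value of
  \<open>at_map\<close>. Functoriality, naturality of \<open>eps\<close> and a triangle identity are
  checked in this way.\<close>

lemma at_map_eqI:
  assumes x: "x \<in> mt_atoms N" and y: "y \<in> mt_atoms M" and le: "x \<sqsubseteq>\<^bsub>N\<^esub> f y"
  shows "at_map M N f x = y"
proof -
  have "at_map M N f x \<sqsubseteq>\<^bsub>M\<^esub> y" using at_map_le_iff[OF x M.atom_carrier[OF y]] le by simp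
  then show ?thesis using M.atom_le_atom_iff[OF at_map_atom[OF x] y] by simp
qed

text \<open>The adjunction read as an equation of sets. It is the common source of continuity and
  properness of \<open>at_map\<close> and of naturality of \<open>eta\<close>.\<close>

lemma at_map_vimage_eta:
  assumes "a \<in> carrier M"
  shows "{x \<in> mt_atoms N. at_map M N f x \<in> eta M a} = eta N (f a)"
  using assms by (auto simp: M.eta_eq N.eta_eq map_carrier at_map_le_iff at_map_atom)

lemma continuous_at_map: "continuous_map (at_obj N) (at_obj M) (at_map M N f)"
  unfolding continuous_map_def
proof (intro conjI allI impI)
  show "at_map M N f \<in> topspace (at_obj N) \<rightarrow> topspace (at_obj M)"
    by (simp add: M.topspace_at_obj N.topspace_at_obj at_map_atom)
  fix U assume "openin (at_obj M) U"
  then obtain u where u: "u \<in> mt_opens M" "U = eta M u" by (auto simp: M.openin_at_obj)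
  have "{x \<in> topspace (at_obj N). at_map M N f x \<in> U} = eta N (f u)"
    unfolding N.topspace_at_obj u(2) by (rule at_map_vimage_eta[OF M.open_carrier[OF u(1)]])
  then show "openin (at_obj N) {x \<in> topspace (at_obj N). at_map M N f x \<in> U}"
    using map_open[OF u(1)] by (auto simp: N.openin_at_obj)
qed

end

section \<open>Proper morphisms, identities and composition\<close>

lemma LCSobMT_sober: "M \<in> LCSobMT \<Longrightarrow> sober_mt_algebra M"
  by (simp add: LCSobMT_def sober_mt_algebra_def sober_mt_algebra_axioms_def)

lemma LCSobMT_algebra: "M \<in> LCSobMT \<Longrightarrow> mt_algebra M"
  by (simp add: LCSobMT_def)

lemma LCSobMT_hom_mt_hom:
  "\<lbrakk>M \<in> LCSobMT; N \<in> LCSobMT; f \<in> LCSobMT_hom M N\<rbrakk> \<Longrightarrow> mt_hom M N f"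
  by (simp add: LCSobMT_hom_def mt_hom_def mt_hom_axioms_def LCSobMT_algebra)

lemma LCSobMT_hom_PiE: "f \<in> LCSobMT_hom M N \<Longrightarrow> f \<in> carrier M \<rightarrow>\<^sub>E carrier N"
  by (simp add: LCSobMT_hom_def mt_morphisms_def)

lemma LCSob_hom_PiE: "f \<in> LCSob_hom X Y \<Longrightarrow> f \<in> topspace X \<rightarrow>\<^sub>E topspace Y"
  by (simp add: LCSob_hom_def)

lemma LCSob_hom_compact:
  "\<lbrakk>f \<in> LCSob_hom X Y; compactin Y K; saturatedin Y K\<rbrakk> \<Longrightarrow> compactin X {x \<in> topspace X. f x \<in> K}"
  by (simp add: LCSob_hom_def)

lemma KS_carrier: "k \<in> mt_KS M \<Longrightarrow> k \<in> carrier M"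
  by (simp add: mt_KS_def mt_compact_def)

lemma at_map_LCSob_hom:
  assumes M: "M \<in> LCSobMT" and N: "N \<in> LCSobMT" and f: "f \<in> LCSobMT_hom M N"
  shows "at_map M N f \<in> LCSob_hom (at_obj N) (at_obj M)"
proof -
  interpret mt_hom M N f using assms by (rule LCSobMT_hom_mt_hom)
  interpret SM: sober_mt_algebra M using M by (rule LCSobMT_sober)
  interpret SN: sober_mt_algebra N using N by (rule LCSobMT_sober)
  have "at_map M N f \<in> topspace (at_obj N) \<rightarrow>\<^sub>E topspace (at_obj M)"
    by (auto simp: M.topspace_at_obj N.topspace_at_obj at_map_atom) (simp add: at_map_def)
  moreover have "compactin (at_obj N) {x \<in> topspace (at_obj N). at_map M N f x \<in> K}"
    if K: "compactin (at_obj M) K" "saturatedin (at_obj M) K" for K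
  proof -
    obtain k where k: "k \<in> mt_KS M" "K = eta M k" using SM.compact_saturated_eq_eta[OF K] by blast
    have "f k \<in> mt_KS N" using f k by (simp add: LCSobMT_hom_def)
    then show ?thesis
      using SN.eta_compact at_map_vimage_eta[OF KS_carrier[OF k(1)]]
      by (simp add: N.topspace_at_obj k(2))
  qed
  ultimately show ?thesis using continuous_at_map by (simp add: LCSob_hom_def)
qed

lemma identity_LCSobMT_hom:
  assumes "M \<in> LCSobMT"
  shows "(\<lambda>a\<in>carrier M. a) \<in> LCSobMT_hom M M"
proof -
  interpret mt_algebra M using assms by (rule LCSobMT_algebra)
  have *: "(\<lambda>a\<in>carrier M. a) ` S = S" if "S \<subseteq> carrier M" for S using that by (force simp: image_iff)
  have "(\<lambda>a\<in>carrier M. a) \<in> mt_morphisms M M"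
    unfolding mt_morphisms_def by (intro CollectI conjI allI impI ballI; (subst *)?) (simp_all add: box_closed)
  then show ?thesis by (auto simp: LCSobMT_hom_def KS_carrier)
qed

lemma compose_LCSobMT_hom:
  assumes M: "M \<in> LCSobMT" and N: "N \<in> LCSobMT" and K: "K \<in> LCSobMT"
    and f: "f \<in> LCSobMT_hom M N" and g: "g \<in> LCSobMT_hom N K"
  shows "compose (carrier M) g f \<in> LCSobMT_hom M K"
proof -
  interpret F: mt_hom M N f using M N f by (rule LCSobMT_hom_mt_hom)
  interpret G: mt_hom N K g using N K g by (rule LCSobMT_hom_mt_hom)
  have img: "compose (carrier M) g f ` S = g ` f ` S" "f ` S \<subseteq> carrier N" if "S \<subseteq> carrier M" for S
    using that F.map_carrier by (auto simp: compose_def image_iff subset_iff)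
  have box: "g (f (mt_box M a)) \<sqsubseteq>\<^bsub>K\<^esub> mt_box K (g (f a))" if a: "a \<in> carrier M" for a
  proof (rule G.N.le_trans)
    show "g (f (mt_box M a)) \<sqsubseteq>\<^bsub>K\<^esub> g (mt_box N (f a))"
      using a by (intro G.map_mono F.map_box)
        (auto simp: F.map_carrier F.M.box_closed F.N.box_closed)
    show "g (mt_box N (f a)) \<sqsubseteq>\<^bsub>K\<^esub> mt_box K (g (f a))" using a by (intro G.map_box F.map_carrier)
  qed (use a in \<open>auto simp: F.map_carrier G.map_carrier F.M.box_closed F.N.box_closed G.N.box_closed\<close>)
  have "compose (carrier M) g f \<in> mt_morphisms M K"
    unfolding mt_morphisms_def
  proof (intro CollectI conjI allI impI ballI)
    show "compose (carrier M) g f \<in> carrier M \<rightarrow>\<^sub>E carrier K"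
      by (auto simp: compose_def F.map_carrier G.map_carrier)
  next
    fix S assume S: "S \<subseteq> carrier M"
    show "compose (carrier M) g f (\<Squnion>\<^bsub>M\<^esub> S) = \<Squnion>\<^bsub>K\<^esub> (compose (carrier M) g f ` S)"
      using S img[OF S] by (simp add: compose_eq F.map_sup G.map_sup)
    show "compose (carrier M) g f (\<Sqinter>\<^bsub>M\<^esub> S) = \<Sqinter>\<^bsub>K\<^esub> (compose (carrier M) g f ` S)"
      using S img[OF S] by (simp add: compose_eq F.map_inf G.map_inf)
  next
    fix a assume a: "a \<in> carrier M"
    show "compose (carrier M) g f (mt_compl M a) = mt_compl K (compose (carrier M) g f a)"
      using a by (simp add: compose_eq F.map_compl G.map_compl F.map_carrier)
    show "compose (carrier M) g f (mt_box M a) \<sqsubseteq>\<^bsub>K\<^esub> mt_box K (compose (carrier M) g f a)"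
      using a box by (simp add: compose_eq F.M.box_closed)
  qed
  moreover have "compose (carrier M) g f a \<in> mt_KS K" if "a \<in> mt_KS M" for a
    using that f g by (simp add: compose_eq KS_carrier LCSobMT_hom_def)
  ultimately show ?thesis by (simp add: LCSobMT_hom_def)
qed

text \<open>Properness of a map tests only saturated sets and asserts only compactness of their
  preimages. Saturation of the preimage is needed to compose two proper maps, and to place the
  preimage in \<open>mt_KS\<close>.\<close>

lemma saturatedin_vimage:
  assumes f: "continuous_map X Y f" and K: "saturatedin Y K"
  shows "saturatedin X {x \<in> topspace X. f x \<in> K}"
proof -
  obtain \<U> where \<U>: "\<U> \<subseteq> {U. openin Y U}" "K = topspace Y \<inter> \<Inter>\<U>"
    using K by (auto simp: saturatedin_def)
  let ?V = "(\<lambda>U. {x \<in> topspace X. f x \<in> U}) ` \<U>"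
  have "?V \<subseteq> {U. openin X U}" using \<U>(1) f by (auto intro: openin_continuous_map_preimage)
  moreover have "{x \<in> topspace X. f x \<in> K} = topspace X \<inter> \<Inter>?V"
    using f by (auto simp: \<U>(2) continuous_map_def)
  ultimately show ?thesis unfolding saturatedin_def by (intro exI[of _ ?V] conjI)
qed

lemma identity_LCSob_hom: "(\<lambda>x\<in>topspace X. x) \<in> LCSob_hom X X"
proof -
  have "continuous_map X X (\<lambda>x\<in>topspace X. x)"
    by (rule continuous_map_eq[OF continuous_map_id]) simp
  moreover have "{x \<in> topspace X. (\<lambda>x\<in>topspace X. x) x \<in> K} = K" if "compactin X K" for K
    using compactin_subset_topspace[OF that] by auto
  ultimately show ?thesis by (auto simp: LCSob_hom_def)
qed

lemma compose_LCSob_hom: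
  assumes f: "f \<in> LCSob_hom X Y" and g: "g \<in> LCSob_hom Y Z"
  shows "compose (topspace X) g f \<in> LCSob_hom X Z"
proof -
  have fc: "continuous_map X Y f" and gc: "continuous_map Y Z g"
    using f g by (auto simp: LCSob_hom_def)
  have fm: "f x \<in> topspace Y" if "x \<in> topspace X" for x
    using fc that by (auto simp: continuous_map_def)
  have "compose (topspace X) g f \<in> topspace X \<rightarrow>\<^sub>E topspace Z"
    using f g by (auto simp: LCSob_hom_def compose_def)
  moreover have "continuous_map X Z (compose (topspace X) g f)"
    by (rule continuous_map_eq[OF continuous_map_compose[OF fc gc]]) (simp add: compose_eq)
  moreover have "compactin X {x \<in> topspace X. compose (topspace X) g f x \<in> K}"
    if K: "compactin Z K" "saturatedin Z K" for K
  proof -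
    let ?L = "{y \<in> topspace Y. g y \<in> K}"
    have "compactin Y ?L" using g K by (simp add: LCSob_hom_def)
    moreover have "saturatedin Y ?L" using gc K(2) by (rule saturatedin_vimage)
    ultimately have "compactin X {x \<in> topspace X. f x \<in> ?L}" by (rule LCSob_hom_compact[OF f])
    moreover have "{x \<in> topspace X. f x \<in> ?L} = {x \<in> topspace X. compose (topspace X) g f x \<in> K}"
      using fm by (auto simp: compose_eq)
    ultimately show ?thesis by simp
  qed
  ultimately show ?thesis by (simp add: LCSob_hom_def)
qed

section \<open>Functoriality of \<open>P_map\<close> and \<open>at_map\<close>\<close>

lemma P_map_eq: "A \<subseteq> topspace Y \<Longrightarrow> P_map X Y f A = {x \<in> topspace X. f x \<in> A}"
  by (simp add: P_map_def)

text \<open>The box inequality is continuity: the preimage of an interior is open, hence contained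
  in the interior of the preimage. Compact saturated sets are preserved by properness together with
  \<open>saturatedin_vimage\<close>.\<close>

lemma P_map_LCSobMT_hom:
  assumes f: "f \<in> LCSob_hom X Y"
  shows "P_map X Y f \<in> LCSobMT_hom (P_obj Y) (P_obj X)"
proof -
  have fc: "continuous_map X Y f" using f by (simp add: LCSob_hom_def)
  have fm: "f x \<in> topspace Y" if "x \<in> topspace X" for x
    using fc that by (auto simp: continuous_map_def)
  have "P_map X Y f \<in> mt_morphisms (P_obj Y) (P_obj X)"
    unfolding mt_morphisms_def
  proof (intro CollectI conjI allI impI ballI)
    show "P_map X Y f \<in> carrier (P_obj Y) \<rightarrow>\<^sub>E carrier (P_obj X)" by (auto simp: P_map_def)
  next
    fix S assume "S \<subseteq> carrier (P_obj Y)"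
    then have S: "S \<subseteq> Pow (topspace Y)" by simp
    have S': "P_map X Y f ` S \<subseteq> Pow (topspace X)" using S by (auto simp: P_map_eq)
    have *: "x \<in> P_map X Y f A \<longleftrightarrow> x \<in> topspace X \<and> f x \<in> A" if "A \<in> S" for x A
      using that S by (auto simp: P_map_def)
    have "\<Union>S \<subseteq> topspace Y" using S by blast
    then show "P_map X Y f (\<Squnion>\<^bsub>P_obj Y\<^esub> S) = \<Squnion>\<^bsub>P_obj X\<^esub> (P_map X Y f ` S)"
      unfolding sup_P_obj[OF S] sup_P_obj[OF S'] using * by (auto simp: P_map_eq)
    show "P_map X Y f (\<Sqinter>\<^bsub>P_obj Y\<^esub> S) = \<Sqinter>\<^bsub>P_obj X\<^esub> (P_map X Y f ` S)"
      unfolding inf_P_obj[OF S] inf_P_obj[OF S'] using * fm by (auto simp: P_map_eq)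
  next
    fix A assume "A \<in> carrier (P_obj Y)"
    then have A: "A \<subseteq> topspace Y" by simp
    show "P_map X Y f (mt_compl (P_obj Y) A) = mt_compl (P_obj X) (P_map X Y f A)"
      using A fm by (subst compl_P_obj) (auto simp: compl_P_obj P_map_eq)
    have "openin X {x \<in> topspace X. f x \<in> Y interior_of A}"
      using fc by (rule openin_continuous_map_preimage) simp
    then have "{x \<in> topspace X. f x \<in> Y interior_of A} \<subseteq> X interior_of {x \<in> topspace X. f x \<in> A}"
      using interior_of_subset[of Y A] by (intro interior_of_maximal) auto
    then show "P_map X Y f (mt_box (P_obj Y) A) \<sqsubseteq>\<^bsub>P_obj X\<^esub> mt_box (P_obj X) (P_map X Y f A)"
      using A by (simp add: P_map_eq interior_of_subset_topspace)
  qed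
  moreover have "P_map X Y f K \<in> mt_KS (P_obj X)" if "K \<in> mt_KS (P_obj Y)" for K
  proof -
    have K: "compactin Y K" "saturatedin Y K" using that by (auto simp: KS_P_obj)
    then show ?thesis
      using f fc by (simp add: KS_P_obj P_map_eq compactin_subset_topspace saturatedin_vimage LCSob_hom_def)
  qed
  ultimately show ?thesis by (simp add: LCSobMT_hom_def)
qed

lemma P_map_compose:
  assumes "f \<in> LCSob_hom X Y"
  shows "P_map X Z (compose (topspace X) g f) =
    compose (carrier (P_obj Z)) (P_map X Y f) (P_map Y Z g)"
proof -
  have "f x \<in> topspace Y" if "x \<in> topspace X" for x
    using that LCSob_hom_PiE[OF assms] by auto
  then show ?thesis by (auto simp: P_map_def compose_def fun_eq_iff)
qed

text \<open>Using the adjunction once for \<open>f\<close> and once for \<open>g\<close> places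
  \<open>x\<close> below the composite applied to the iterated image of \<open>x\<close>;
  \<open>at_map_eqI\<close> needs no more.\<close>

lemma at_map_compose:
  assumes M: "M \<in> LCSobMT" and N: "N \<in> LCSobMT" and K: "K \<in> LCSobMT"
    and f: "f \<in> LCSobMT_hom M N" and g: "g \<in> LCSobMT_hom N K"
  shows "at_map M K (compose (carrier M) g f) =
    compose (topspace (at_obj K)) (at_map M N f) (at_map N K g)"
proof
  fix x
  interpret F: mt_hom M N f using M N f by (rule LCSobMT_hom_mt_hom)
  interpret G: mt_hom N K g using N K g by (rule LCSobMT_hom_mt_hom)
  interpret GF: mt_hom M K "compose (carrier M) g f"
    using M K compose_LCSobMT_hom[OF assms] by (rule LCSobMT_hom_mt_hom)
  show "at_map M K (compose (carrier M) g f) x =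
    compose (topspace (at_obj K)) (at_map M N f) (at_map N K g) x"
  proof (cases "x \<in> mt_atoms K")
    case True
    let ?y = "at_map M N f (at_map N K g x)"
    have gx: "at_map N K g x \<in> mt_atoms N" using True by (rule G.at_map_atom)
    have y: "?y \<in> mt_atoms M" using gx by (rule F.at_map_atom)
    have yc: "?y \<in> carrier M" using y by (rule F.M.atom_carrier)
    have "at_map N K g x \<sqsubseteq>\<^bsub>N\<^esub> f ?y" using F.at_map_le_iff[OF gx yc] yc by simp
    then have "x \<sqsubseteq>\<^bsub>K\<^esub> g (f ?y)" using G.at_map_le_iff[OF True F.map_carrier[OF yc]] by simp
    then have "at_map M K (compose (carrier M) g f) x = ?y"
      using yc by (intro GF.at_map_eqI[OF True y]) (simp add: compose_eq)
    then show ?thesis using True by (simp add: compose_def G.N.topspace_at_obj)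
  next
    case False
    then show ?thesis by (simp add: compose_def at_map_def G.N.topspace_at_obj)
  qed
qed

lemma at_map_identity:
  assumes M: "M \<in> LCSobMT"
  shows "at_map M M (\<lambda>a\<in>carrier M. a) = (\<lambda>x\<in>topspace (at_obj M). x)"
proof
  fix x
  interpret mt_hom M M "\<lambda>a\<in>carrier M. a"
    using M M identity_LCSobMT_hom[OF M] by (rule LCSobMT_hom_mt_hom)
  show "at_map M M (\<lambda>a\<in>carrier M. a) x = (\<lambda>x\<in>topspace (at_obj M). x) x"
  proof (cases "x \<in> mt_atoms M")
    case True
    then have "at_map M M (\<lambda>a\<in>carrier M. a) x = x"
      by (intro at_map_eqI) (simp_all add: M.atom_carrier)
    then show ?thesis using True by (simp add: M.topspace_at_obj)
  qed (simp add: at_map_def M.topspace_at_obj)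
qed

section \<open>The units\<close>

lemma eta_LCSobMT_hom:
  assumes M: "M \<in> LCSobMT"
  shows "eta M \<in> LCSobMT_hom M (P_obj (at_obj M))"
proof -
  interpret sober_mt_algebra M using M by (rule LCSobMT_sober)
  have sub: "eta M ` S \<subseteq> Pow (topspace (at_obj M))" if "S \<subseteq> carrier M" for S
    using that by (auto simp: topspace_at_obj eta_eq)
  have "eta M \<in> mt_morphisms M (P_obj (at_obj M))"
    unfolding mt_morphisms_def
  proof (intro CollectI conjI allI impI ballI)
    show "eta M \<in> carrier M \<rightarrow>\<^sub>E carrier (P_obj (at_obj M))"
      by (auto simp: eta_def topspace_at_obj)
  next
    fix S assume S: "S \<subseteq> carrier M"
    show "eta M (\<Squnion>\<^bsub>M\<^esub> S) = \<Squnion>\<^bsub>P_obj (at_obj M)\<^esub> (eta M ` S)"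
      unfolding sup_P_obj[OF sub[OF S]] using S by (rule eta_sup)
    show "eta M (\<Sqinter>\<^bsub>M\<^esub> S) = \<Sqinter>\<^bsub>P_obj (at_obj M)\<^esub> (eta M ` S)"
      unfolding inf_P_obj[OF sub[OF S]] topspace_at_obj using S by (rule eta_inf)
  next
    fix a assume a: "a \<in> carrier M"
    have s: "eta M a \<subseteq> topspace (at_obj M)" using a by (simp add: topspace_at_obj eta_subset_atoms)
    show "eta M (mt_compl M a) = mt_compl (P_obj (at_obj M)) (eta M a)"
      unfolding compl_P_obj[OF s] topspace_at_obj using a by (rule eta_compl)
    have "openin (at_obj M) (eta M (mt_box M a))" using a box_open by (auto simp: openin_at_obj)
    moreover have "eta M (mt_box M a) \<subseteq> eta M a" using a by (simp add: eta_mono box_le box_closed)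
    ultimately show "eta M (mt_box M a) \<sqsubseteq>\<^bsub>P_obj (at_obj M)\<^esub> mt_box (P_obj (at_obj M)) (eta M a)"
      by (simp add: interior_of_maximal)
  qed
  moreover have "eta M k \<in> mt_KS (P_obj (at_obj M))" if "k \<in> mt_KS M" for k
    using eta_compact[OF that] eta_saturated[of k] that unfolding KS_P_obj by (simp add: mt_KS_def)
  ultimately show ?thesis by (simp add: LCSobMT_hom_def)
qed

lemma eta_natural:
  assumes M: "M \<in> LCSobMT" and N: "N \<in> LCSobMT" and f: "f \<in> LCSobMT_hom M N"
  shows "compose (carrier M) (P_map (at_obj N) (at_obj M) (at_map M N f)) (eta M) =
    compose (carrier M) (eta N) f"
proof -
  interpret mt_hom M N f using assms by (rule LCSobMT_hom_mt_hom)
  have "P_map (at_obj N) (at_obj M) (at_map M N f) (eta M a) = eta N (f a)" if a: "a \<in> carrier M" for a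
    using at_map_vimage_eta[OF a] a
    by (simp add: P_map_eq M.topspace_at_obj N.topspace_at_obj M.eta_subset_atoms)
  then show ?thesis unfolding compose_def by (intro restrict_ext) simp
qed

lemma eps_vimage_eta: "A \<subseteq> topspace X \<Longrightarrow> {x \<in> topspace X. eps X x \<in> eta (P_obj X) A} = A"
  by (auto simp: eps_def eta_P_obj)

text \<open>Open and compact saturated sets of the target are values of \<open>eta (P_obj X)\<close>
  at open and compact saturated sets of \<open>X\<close>, by \<open>openin_at_obj\<close> and
  \<open>compact_saturated_eq_eta\<close>; their preimages under \<open>eps X\<close> are those sets
  themselves.\<close>

lemma eps_LCSob_hom:
  assumes X: "X \<in> LCSob"
  shows "eps X \<in> LCSob_hom X (at_obj (P_obj X))"
proof -
  interpret sober_mt_algebra "P_obj X" using P_obj_LCSobMT[OF X] by (rule LCSobMT_sober)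
  have "eps X \<in> topspace X \<rightarrow>\<^sub>E topspace (at_obj (P_obj X))"
    by (auto simp: eps_def topspace_at_P_obj)
  moreover have "continuous_map X (at_obj (P_obj X)) (eps X)"
    unfolding continuous_map_def
  proof (intro conjI allI impI)
    show "eps X \<in> topspace X \<rightarrow> topspace (at_obj (P_obj X))"
      by (auto simp: eps_def topspace_at_P_obj)
    fix U assume "openin (at_obj (P_obj X)) U"
    then obtain V where V: "openin X V" "U = eta (P_obj X) V"
      by (auto simp: openin_at_obj opens_P_obj)
    then show "openin X {x \<in> topspace X. eps X x \<in> U}"
      by (simp add: eps_vimage_eta openin_subset)
  qed
  moreover have "compactin X {x \<in> topspace X. eps X x \<in> K}"
    if K: "compactin (at_obj (P_obj X)) K" "saturatedin (at_obj (P_obj X)) K" for K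
  proof -
    obtain L where L: "L \<in> mt_KS (P_obj X)" "K = eta (P_obj X) L"
      using compact_saturated_eq_eta[OF K] by blast
    then have "compactin X L" by (simp add: KS_P_obj)
    then show ?thesis by (simp add: L(2) eps_vimage_eta compactin_subset_topspace)
  qed
  ultimately show ?thesis by (simp add: LCSob_hom_def)
qed

lemma eps_natural:
  assumes X: "X \<in> LCSob" and Y: "Y \<in> LCSob" and f: "f \<in> LCSob_hom X Y"
  shows "compose (topspace X) (at_map (P_obj Y) (P_obj X) (P_map X Y f)) (eps X) =
    compose (topspace X) (eps Y) f"
proof -
  interpret mt_hom "P_obj Y" "P_obj X" "P_map X Y f"
    using P_obj_LCSobMT[OF Y] P_obj_LCSobMT[OF X] P_map_LCSobMT_hom[OF f]
    by (rule LCSobMT_hom_mt_hom)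
  have "at_map (P_obj Y) (P_obj X) (P_map X Y f) {x} = {f x}" if x: "x \<in> topspace X" for x
  proof -
    \<comment> \<open>The candidate \<open>{f x}\<close> is an atom and \<open>x\<close> lies in its
      preimage, which identifies the value of \<open>at_map\<close>.\<close>
    have "f x \<in> topspace Y" using x LCSob_hom_PiE[OF f] by auto
    then show ?thesis using x by (intro at_map_eqI) (auto simp: atoms_P_obj P_map_eq)
  qed
  then show ?thesis using LCSob_hom_PiE[OF f] by (auto simp: compose_def eps_def fun_eq_iff)
qed

text \<open>With contravariant functors both triangle identities have the same shape: a unit
  followed by the image of the other unit under the functor is an identity.\<close>

lemma triangle_P:
  "compose (carrier (P_obj X)) (P_map X (at_obj (P_obj X)) (eps X)) (eta (P_obj X)) =
    (\<lambda>A\<in>carrier (P_obj X). A)"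
proof -
  have "P_map X (at_obj (P_obj X)) (eps X) (eta (P_obj X) A) = A" if A: "A \<subseteq> topspace X" for A
  proof -
    have "eta (P_obj X) A \<subseteq> topspace (at_obj (P_obj X))"
      using A by (auto simp: eta_P_obj topspace_at_P_obj)
    then show ?thesis using eps_vimage_eta[OF A] by (simp add: P_map_eq)
  qed
  then show ?thesis unfolding compose_def by (intro restrict_ext) simp
qed

lemma triangle_at:
  assumes M: "M \<in> LCSobMT"
  shows "compose (topspace (at_obj M)) (at_map M (P_obj (at_obj M)) (eta M)) (eps (at_obj M)) =
    (\<lambda>x\<in>topspace (at_obj M). x)"
proof -
  interpret mt_hom M "P_obj (at_obj M)" "eta M"
    using M P_obj_LCSobMT[OF at_obj_LCSob[OF M]] eta_LCSobMT_hom[OF M] by (rule LCSobMT_hom_mt_hom)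
  have "at_map M (P_obj (at_obj M)) (eta M) {x} = x" if x: "x \<in> mt_atoms M" for x
    using x by (intro at_map_eqI) (auto simp: atoms_P_obj M.topspace_at_obj M.eta_atom)
  then show ?thesis
    unfolding compose_def eps_def M.topspace_at_obj by (intro restrict_ext) simp
qed

section \<open>Invertibility of the units\<close>

lemma eps_iso:
  assumes X: "X \<in> LCSob"
  shows "LCSob_iso X (at_obj (P_obj X)) (eps X)"
  unfolding LCSob_iso_def
proof (intro conjI bexI)
  interpret sober_mt_algebra "P_obj X" using P_obj_LCSobMT[OF X] by (rule LCSobMT_sober)
  let ?Y = "at_obj (P_obj X)"
  let ?g = "\<lambda>A\<in>topspace ?Y. the_elem A"
  show "eps X \<in> LCSob_hom X ?Y" using X by (rule eps_LCSob_hom)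
  show "compose (topspace X) ?g (eps X) = (\<lambda>x\<in>topspace X. x)"
    by (auto simp: compose_def eps_def topspace_at_P_obj)
  show "compose (topspace ?Y) (eps X) ?g = (\<lambda>y\<in>topspace ?Y. y)"
    by (auto simp: compose_def eps_def topspace_at_P_obj fun_eq_iff)
  \<comment> \<open>Preimages under the inverse are values of \<open>eta (P_obj X)\<close>, so its
    continuity and properness reduce to \<open>openin_at_obj\<close> and
    \<open>eta_compact\<close>.\<close>
  have vim: "{A \<in> topspace ?Y. ?g A \<in> B} = eta (P_obj X) B" if "B \<subseteq> topspace X" for B
    using that by (auto simp: topspace_at_P_obj eta_P_obj)
  have "?g \<in> topspace ?Y \<rightarrow>\<^sub>E topspace X" by (auto simp: topspace_at_P_obj)
  moreover have "continuous_map ?Y X ?g"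
    unfolding continuous_map_def
  proof (intro conjI allI impI)
    show "?g \<in> topspace ?Y \<rightarrow> topspace X" by (auto simp: topspace_at_P_obj)
    fix U assume "openin X U"
    then show "openin ?Y {A \<in> topspace ?Y. ?g A \<in> U}"
      unfolding openin_at_obj opens_P_obj by (subst vim) (auto simp: openin_subset)
  qed
  moreover have "compactin ?Y {A \<in> topspace ?Y. ?g A \<in> K}"
    if K: "compactin X K" "saturatedin X K" for K
    unfolding vim[OF compactin_subset_topspace[OF K(1)]]
    using K by (intro eta_compact) (simp add: KS_P_obj)
  ultimately show "?g \<in> LCSob_hom ?Y X" by (simp add: LCSob_hom_def)
qed

text \<open>If \<open>a\<close> is not below \<open>b\<close>, then \<open>a\<close> meets the
  complement of \<open>b\<close> in a nonzero element, and an atom below that separates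
  \<open>eta M a\<close> from \<open>eta M b\<close>.\<close>

lemma (in mt_algebra) spatial_eta_subset_iff:
  assumes "mt_spatial M" "a \<in> carrier M" "b \<in> carrier M"
  shows "eta M a \<subseteq> eta M b \<longleftrightarrow> a \<sqsubseteq> b"
proof
  assume sub: "eta M a \<subseteq> eta M b"
  show "a \<sqsubseteq> b"
  proof (rule ccontr)
    assume "\<not> a \<sqsubseteq> b"
    then have "mt_compl M b \<sqinter> a \<noteq> \<bottom>" using le_compl_iff[of "mt_compl M b" a] assms by simp
    moreover have "mt_compl M b \<sqinter> a \<in> carrier M" using assms by simp
    ultimately obtain x where x: "x \<in> mt_atoms M" "x \<sqsubseteq> mt_compl M b \<sqinter> a"
      using assms(1) unfolding mt_spatial_def by blast
    then have "x \<sqsubseteq> mt_compl M b" "x \<sqsubseteq> a" using assms by (simp_all add: le_meet_iff atom_carrier)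
    moreover have "x \<sqsubseteq> b" using sub x(1) \<open>x \<sqsubseteq> a\<close> assms by (auto simp: eta_eq)
    ultimately show False using x(1) assms by (simp add: atom_le_compl_iff)
  qed
qed (use assms in \<open>simp add: eta_mono\<close>)

text \<open>The inverse sends a set of atoms to its join. That it is a left inverse rests on
  injectivity of \<open>eta M\<close>, the consequence of spatiality.\<close>

lemma eta_iso:
  assumes M: "M \<in> LCSobSMT"
  shows "LCSobMT_iso M (P_obj (at_obj M)) (eta M)"
  unfolding LCSobMT_iso_def
proof (intro conjI bexI)
  have MT: "M \<in> LCSobMT" and sp: "mt_spatial M" using M by (auto simp: LCSobSMT_def)
  interpret sober_mt_algebra M using MT by (rule LCSobMT_sober)
  let ?P = "P_obj (at_obj M)"
  let ?g = "\<lambda>A\<in>carrier ?P. \<Squnion>\<^bsub>M\<^esub> A"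
  have car: "carrier ?P = Pow (mt_atoms M)" by (simp add: topspace_at_obj)
  have gc: "?g A \<in> carrier M" if "A \<subseteq> mt_atoms M" for A
    using that atom_carrier unfolding car by (auto simp: subset_iff)
  have eta_g: "eta M (?g A) = A" if A: "A \<subseteq> mt_atoms M" for A
  proof -
    have "eta M (\<Squnion>\<^bsub>M\<^esub> A) = \<Union>(eta M ` A)" using A atom_carrier by (intro eta_sup) blast
    also have "\<dots> = A" using A eta_atom by force
    finally show ?thesis using A by (simp add: topspace_at_obj)
  qed
  have eta_eqD: "a = b" if "eta M a = eta M b" "a \<in> carrier M" "b \<in> carrier M" for a b
    using that spatial_eta_subset_iff[OF sp, of a b] spatial_eta_subset_iff[OF sp, of b a]
    by (simp add: le_antisym)
  have g_eta: "?g (eta M a) = a" if a: "a \<in> carrier M" for a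
    using a eta_g[OF eta_subset_atoms[OF a]] by (intro eta_eqD gc eta_subset_atoms)
  interpret mt_hom M ?P "eta M"
    using MT P_obj_LCSobMT[OF at_obj_LCSob[OF MT]] eta_LCSobMT_hom[OF MT] by (rule LCSobMT_hom_mt_hom)
  show "eta M \<in> LCSobMT_hom M ?P" using MT by (rule eta_LCSobMT_hom)
  show "compose (carrier M) ?g (eta M) = (\<lambda>a\<in>carrier M. a)"
    using g_eta unfolding compose_def by (intro restrict_ext)
  show "compose (carrier ?P) (eta M) ?g = (\<lambda>b\<in>carrier ?P. b)"
    using eta_g unfolding compose_def car by (intro restrict_ext) blast
  have "?g \<in> mt_morphisms ?P M"
    unfolding mt_morphisms_def
  proof (intro CollectI conjI allI impI ballI)
    show "?g \<in> carrier ?P \<rightarrow>\<^sub>E carrier M" using atom_carrier by (auto simp: topspace_at_obj intro!: sup_closed)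
  next
    fix S assume S: "S \<subseteq> carrier ?P"
    have gS: "?g ` S \<subseteq> carrier M" using S gc unfolding car by blast
    \<comment> \<open>Preservation of joins, meets and complements by the inverse is inherited from
      \<open>eta M\<close>: express the arguments as values of \<open>eta M\<close>, move
      \<open>eta M\<close> outside, and cancel with \<open>g_eta\<close>.\<close>
    have img: "eta M ` ?g ` S = S"
    proof -
      have "eta M ` ?g ` S = (\<lambda>A. A) ` S"
        unfolding image_image using S eta_g unfolding car by (intro image_cong) blast+
      then show ?thesis by simp
    qed
    have "?g (\<Squnion>\<^bsub>?P\<^esub> S) = ?g (eta M (\<Squnion>\<^bsub>M\<^esub> (?g ` S)))" unfolding map_sup[OF gS] img ..
    then show "?g (\<Squnion>\<^bsub>?P\<^esub> S) = \<Squnion>\<^bsub>M\<^esub> (?g ` S)" unfolding g_eta[OF sup_closed[OF gS]] .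
    have "?g (\<Sqinter>\<^bsub>?P\<^esub> S) = ?g (eta M (\<Sqinter>\<^bsub>M\<^esub> (?g ` S)))" unfolding map_inf[OF gS] img ..
    then show "?g (\<Sqinter>\<^bsub>?P\<^esub> S) = \<Sqinter>\<^bsub>M\<^esub> (?g ` S)" unfolding g_eta[OF inf_closed[OF gS]] .
  next
    fix A assume "A \<in> carrier ?P"
    then have A: "A \<subseteq> mt_atoms M" unfolding car by simp
    note gA = gc[OF A]
    have "?g (mt_compl ?P A) = ?g (eta M (mt_compl M (?g A)))" unfolding map_compl[OF gA] eta_g[OF A] ..
    then show "?g (mt_compl ?P A) = mt_compl M (?g A)" unfolding g_eta[OF compl_closed[OF gA]] .
    \<comment> \<open>An MT-morphism satisfies only one box inequality, so its inverse needs a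
      separate argument. The interior of \<open>A\<close> comes from an open \<open>u\<close>, and
      spatiality turns the inclusion of atoms into \<open>u \<sqsubseteq> ?g A\<close>.\<close>
    obtain u where u: "u \<in> mt_opens M" "at_obj M interior_of A = eta M u"
      using openin_interior_of[of "at_obj M" A] unfolding openin_at_obj by blast
    note uc = open_carrier[OF u(1)]
    have "eta M u \<subseteq> eta M (?g A)" using interior_of_subset[of "at_obj M" A] u eta_g[OF A] by simp
    then have "u \<sqsubseteq>\<^bsub>M\<^esub> ?g A" using spatial_eta_subset_iff[OF sp uc gA] by simp
    then have u_le: "u \<sqsubseteq>\<^bsub>M\<^esub> mt_box M (?g A)" using open_le_box_iff[OF u(1) gA] by simp
    have g_box: "?g (mt_box ?P A) = u" unfolding box_P_obj u(2) by (rule g_eta[OF uc])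
    show "?g (mt_box ?P A) \<sqsubseteq>\<^bsub>M\<^esub> mt_box M (?g A)" unfolding g_box by (rule u_le)
  qed
  moreover have "?g K \<in> mt_KS M" if K: "K \<in> mt_KS ?P" for K
  proof -
    \<comment> \<open>Properness of the inverse: \<open>K\<close> comes from a compact saturated
      element of \<open>M\<close>, and cancellation returns that element.\<close>
    obtain k where k: "k \<in> mt_KS M" "K = eta M k"
      using K compact_saturated_eq_eta[of K] by (auto simp: KS_P_obj)
    show ?thesis unfolding k(2) g_eta[OF KS_carrier[OF k(1)]] by (rule k(1))
  qed
  ultimately show "?g \<in> LCSobMT_hom ?P M" unfolding LCSobMT_hom_def by blast
qed

section \<open>Category laws and the dual equivalence\<close>

lemma compose_LCSob_identity:
  assumes "f \<in> LCSob_hom X Y"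
  shows "compose (topspace X) f (\<lambda>x\<in>topspace X. x) = f"
    and "compose (topspace X) (\<lambda>y\<in>topspace Y. y) f = f"
  using LCSob_hom_PiE[OF assms] by (auto simp: PiE_iff intro!: compose_Id Id_compose)

lemma compose_LCSob_assoc:
  assumes "f \<in> LCSob_hom X Y"
  shows "compose (topspace X) h (compose (topspace X) g f) =
    compose (topspace X) (compose (topspace Y) h g) f"
  using LCSob_hom_PiE[OF assms] by (auto simp: PiE_iff intro!: compose_assoc)

lemma compose_LCSobMT_identity:
  assumes "f \<in> LCSobMT_hom M N"
  shows "compose (carrier M) f (\<lambda>a\<in>carrier M. a) = f"
    and "compose (carrier M) (\<lambda>b\<in>carrier N. b) f = f"
  using LCSobMT_hom_PiE[OF assms] by (auto simp: PiE_iff intro!: compose_Id Id_compose)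

lemma compose_LCSobMT_assoc:
  assumes "f \<in> LCSobMT_hom M N"
  shows "compose (carrier M) h (compose (carrier M) g f) =
    compose (carrier M) (compose (carrier N) h g) f"
  using LCSobMT_hom_PiE[OF assms] by (auto simp: PiE_iff intro!: compose_assoc)

lemma P_map_identity: "P_map X X (\<lambda>x\<in>topspace X. x) = (\<lambda>A\<in>carrier (P_obj X). A)"
  unfolding P_map_def by (intro restrict_ext) auto

lemma P_obj_LCSobSMT: "X \<in> LCSob \<Longrightarrow> P_obj X \<in> LCSobSMT"
  by (simp add: LCSobSMT_def P_obj_LCSobMT spatial_P_obj)

lemma at_obj_LCSobSMT: "M \<in> LCSobSMT \<Longrightarrow> at_obj M \<in> LCSob"
  by (simp add: LCSobSMT_def at_obj_LCSob)

text \<open>The dual adjunction is expressed by units, naturality and triangle identities. As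
  \<open>LCSobSMT\<close> is a full subcategory, the equivalence adds that the functors restrict on
  objects and that both units are isomorphisms, with inverses that are proper morphisms too.\<close>

theorem theorem4p22:
  shows
  "\<comment> \<open>LCSob is a category\<close>
   (\<forall>X \<in> (LCSob :: 'a topology set). (\<lambda>x\<in>topspace X. x) \<in> LCSob_hom X X) \<and>
   (\<forall>X \<in> (LCSob :: 'a topology set). \<forall>Y \<in> (LCSob :: 'b topology set).
     \<forall>f \<in> LCSob_hom X Y.
       compose (topspace X) f (\<lambda>x\<in>topspace X. x) = f \<and>
       compose (topspace X) (\<lambda>y\<in>topspace Y. y) f = f) \<and>
   (\<forall>X \<in> (LCSob :: 'a topology set). \<forall>Y \<in> (LCSob :: 'b topology set).
    \<forall>Z \<in> (LCSob :: 'c topology set). \<forall>f \<in> LCSob_hom X Y. \<forall>g \<in> LCSob_hom Y Z.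
       compose (topspace X) g f \<in> LCSob_hom X Z) \<and>
   (\<forall>X \<in> (LCSob :: 'a topology set). \<forall>Y \<in> (LCSob :: 'b topology set).
    \<forall>Z \<in> (LCSob :: 'c topology set). \<forall>W \<in> (LCSob :: 'd topology set).
    \<forall>f \<in> LCSob_hom X Y. \<forall>g \<in> LCSob_hom Y Z. \<forall>h \<in> LCSob_hom Z W.
       compose (topspace X) h (compose (topspace X) g f) =
       compose (topspace X) (compose (topspace Y) h g) f) \<and>

   \<comment> \<open>LCSobMT is a category\<close>
   (\<forall>M \<in> (LCSobMT :: 'e mt_structure set). (\<lambda>a\<in>carrier M. a) \<in> LCSobMT_hom M M) \<and>
   (\<forall>M \<in> (LCSobMT :: 'e mt_structure set). \<forall>N \<in> (LCSobMT :: 'f mt_structure set).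
     \<forall>f \<in> LCSobMT_hom M N.
       compose (carrier M) f (\<lambda>a\<in>carrier M. a) = f \<and>
       compose (carrier M) (\<lambda>b\<in>carrier N. b) f = f) \<and>
   (\<forall>M \<in> (LCSobMT :: 'e mt_structure set). \<forall>N \<in> (LCSobMT :: 'f mt_structure set).
    \<forall>K \<in> (LCSobMT :: 'g mt_structure set). \<forall>f \<in> LCSobMT_hom M N. \<forall>g \<in> LCSobMT_hom N K.
       compose (carrier M) g f \<in> LCSobMT_hom M K) \<and>
   (\<forall>M \<in> (LCSobMT :: 'e mt_structure set). \<forall>N \<in> (LCSobMT :: 'f mt_structure set).
    \<forall>K \<in> (LCSobMT :: 'g mt_structure set). \<forall>L \<in> (LCSobMT :: 'h mt_structure set).
    \<forall>f \<in> LCSobMT_hom M N. \<forall>g \<in> LCSobMT_hom N K. \<forall>h \<in> LCSobMT_hom K L.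
       compose (carrier M) h (compose (carrier M) g f) =
       compose (carrier M) (compose (carrier N) h g) f) \<and>

   \<comment> \<open>P restricts to a contravariant functor from LCSob to LCSobMT\<close>
   (\<forall>X \<in> (LCSob :: 'a topology set). P_obj X \<in> LCSobMT) \<and>
   (\<forall>X \<in> (LCSob :: 'a topology set). \<forall>Y \<in> (LCSob :: 'b topology set).
     \<forall>f \<in> LCSob_hom X Y. P_map X Y f \<in> LCSobMT_hom (P_obj Y) (P_obj X)) \<and>
   (\<forall>X \<in> (LCSob :: 'a topology set).
       P_map X X (\<lambda>x\<in>topspace X. x) = (\<lambda>A\<in>carrier (P_obj X). A)) \<and>
   (\<forall>X \<in> (LCSob :: 'a topology set). \<forall>Y \<in> (LCSob :: 'b topology set).
    \<forall>Z \<in> (LCSob :: 'c topology set). \<forall>f \<in> LCSob_hom X Y. \<forall>g \<in> LCSob_hom Y Z.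
       P_map X Z (compose (topspace X) g f) =
       compose (carrier (P_obj Z)) (P_map X Y f) (P_map Y Z g)) \<and>

   \<comment> \<open>at restricts to a contravariant functor from LCSobMT to LCSob\<close>
   (\<forall>M \<in> (LCSobMT :: 'e mt_structure set). at_obj M \<in> LCSob) \<and>
   (\<forall>M \<in> (LCSobMT :: 'e mt_structure set). \<forall>N \<in> (LCSobMT :: 'f mt_structure set).
     \<forall>f \<in> LCSobMT_hom M N. at_map M N f \<in> LCSob_hom (at_obj N) (at_obj M)) \<and>
   (\<forall>M \<in> (LCSobMT :: 'e mt_structure set).
       at_map M M (\<lambda>a\<in>carrier M. a) = (\<lambda>x\<in>topspace (at_obj M). x)) \<and>
   (\<forall>M \<in> (LCSobMT :: 'e mt_structure set). \<forall>N \<in> (LCSobMT :: 'f mt_structure set).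
    \<forall>K \<in> (LCSobMT :: 'g mt_structure set). \<forall>f \<in> LCSobMT_hom M N. \<forall>g \<in> LCSobMT_hom N K.
       at_map M K (compose (carrier M) g f) =
       compose (topspace (at_obj K)) (at_map M N f) (at_map N K g)) \<and>

   \<comment> \<open>the units are natural transformations of the restricted functors\<close>
   (\<forall>X \<in> (LCSob :: 'a topology set). eps X \<in> LCSob_hom X (at_obj (P_obj X))) \<and>
   (\<forall>X \<in> (LCSob :: 'a topology set). \<forall>Y \<in> (LCSob :: 'b topology set).
     \<forall>f \<in> LCSob_hom X Y.
       compose (topspace X) (at_map (P_obj Y) (P_obj X) (P_map X Y f)) (eps X) =
       compose (topspace X) (eps Y) f) \<and>
   (\<forall>M \<in> (LCSobMT :: 'e mt_structure set). eta M \<in> LCSobMT_hom M (P_obj (at_obj M))) \<and>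
   (\<forall>M \<in> (LCSobMT :: 'e mt_structure set). \<forall>N \<in> (LCSobMT :: 'f mt_structure set).
     \<forall>f \<in> LCSobMT_hom M N.
       compose (carrier M) (P_map (at_obj N) (at_obj M) (at_map M N f)) (eta M) =
       compose (carrier M) (eta N) f) \<and>

   \<comment> \<open>the triangle identities\<close>
   (\<forall>X \<in> (LCSob :: 'a topology set).
       compose (carrier (P_obj X)) (P_map X (at_obj (P_obj X)) (eps X)) (eta (P_obj X)) =
       (\<lambda>A\<in>carrier (P_obj X). A)) \<and>
   (\<forall>M \<in> (LCSobMT :: 'e mt_structure set).
       compose (topspace (at_obj M)) (at_map M (P_obj (at_obj M)) (eta M)) (eps (at_obj M)) =
       (\<lambda>x\<in>topspace (at_obj M). x)) \<and>

   \<comment> \<open>dual equivalence between LCSob and the full subcategory LCSobSMT\<close>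
   (\<forall>X \<in> (LCSob :: 'a topology set). P_obj X \<in> LCSobSMT) \<and>
   (\<forall>M \<in> (LCSobSMT :: 'e mt_structure set). at_obj M \<in> LCSob) \<and>
   (\<forall>X \<in> (LCSob :: 'a topology set). LCSob_iso X (at_obj (P_obj X)) (eps X)) \<and>
   (\<forall>M \<in> (LCSobSMT :: 'e mt_structure set). LCSobMT_iso M (P_obj (at_obj M)) (eta M))"
proof (intro conjI ballI)
qed (simp_all add: identity_LCSob_hom compose_LCSob_hom compose_LCSob_identity
    compose_LCSob_assoc identity_LCSobMT_hom compose_LCSobMT_hom compose_LCSobMT_identity
    compose_LCSobMT_assoc P_obj_LCSobMT P_map_LCSobMT_hom P_map_identity P_map_compose
    at_obj_LCSob at_map_LCSob_hom at_map_identity at_map_compose eps_LCSob_hom eps_natural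
    eta_LCSobMT_hom eta_natural triangle_P triangle_at P_obj_LCSobSMT at_obj_LCSobSMT eps_iso eta_iso
    del: carrier_P_obj)

end
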